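(* Let $(S,\mathcal{A},\mu)$ be a complete, $\sigma$-finite measure space, let $E$ be a Köthe function space over $(S,\mathcal{A},\mu)$, and let $X$ be a Banach space such that the simple functions are dense in the Köthe--Bochner space $E(X)$. (a) If $X$ has the DD2P, then $E(X)$ also has the DD2P. (b) If $X$ has the DLD2P, then $E(X)$ also has the DLD2P. (c) If $X$ has the convex DLD2P, then $E(X)$ also has the convex DLD2P.
   Context: All Banach spaces are real and nontrivial (i.e. $\neq\{0\}$). $B_X$, $S_X$, $X^\ast$ denote the closed unit ball, the unit sphere and the dual space of $X$. A slice of $B_X$ is a set of the form $\{x\in B_X: x^\ast(x)>1-\alpha\}$ with $x^\ast\in S_{X^\ast}$ and $\alpha>0$. $X$ has the DD2P (diametral diameter two property) if for every nonempty relatively weakly open subset $U$ of $B_X$, every $x\in U\cap S_X$ and every $\varepsilon>0$ there exists $y\in U$ with $\|x-y\|\ge 2-\varepsilon$. $X$ has the DLD2P (diametral local diameter two property) if for every slice $S'$ of $B_X$, every $x\in S'\cap S_X$ and every $\varepsilon>0$ there exists $y\in S'$ with $\|x-y\|\ge 2-\varepsilon$. For $x\in S_X$ and $\varepsilon>0$ let $\Delta^X_\varepsilon(x)=\{y\in B_X:\|x-y\|\ge 2-\varepsilon\}$; $x\in S_X$ is a $\Delta$-point if $x\in\overline{\mathrm{conv}}\,\Delta^X_\varepsilon(x)$ (norm-closed convex hull) for every $\varepsilon>0$, and $\Delta_X$ is the set of all $\Delta$-points of $X$. $X$ has the convex DLD2P if $B_X=\overline{\mathrm{conv}}\,\Delta_X$.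 A Köthe function space over a complete, $\sigma$-finite measure space $(S,\mathcal{A},\mu)$ is a Banach space $(E,\|\cdot\|_E)$ of real-valued measurable functions on $S$ modulo equality $\mu$-a.e. such that (1) $\chi_A\in E$ for every $A\in\mathcal{A}$ with $\mu(A)<\infty$; (2) for every $f\in E$ and every $A\in\mathcal{A}$ with $\mu(A)<\infty$, $f$ is $\mu$-integrable over $A$; (3) if $g$ is measurable and $f\in E$ satisfy $|g(t)|\le|f(t)|$ $\mu$-a.e., then $g\in E$ and $\|g\|_E\le\|f\|_E$. A function $f\colon S\to X$ is simple if there are finitely many disjoint sets $A_1,\dots,A_n\in\mathcal{A}$ with $\mu(A_i)<\infty$ for every $i$ such that $f$ is constant on each $A_i$ and $f(t)=0$ for $t\in S\setminus\bigcup_{i=1}^n A_i$. A function $f\colon S\to X$ is Bochner-measurable if there is a sequence $(f_n)$ of simple functions with $\lim_{n\to\infty}\|f_n(t)-f(t)\|=0$ for $\mu$-a.e. $t$. The Köthe--Bochner space $E(X)$ is the Banach space of all Bochner-measurable functions $f\colon S\to X$ (modulo equality $\mu$-a.e.) such that $\|f(\cdot)\|\in E$, with norm $\|f\|_{E(X)}=\big\|\,\|f(\cdot)\|\,\big\|_E$. *)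

theory Defs
  imports "HOL-Analysis.Analysis"
begin

text \<open>
  The elements of a Koethe--Bochner space are a.e.-equivalence classes of functions, and the
  underlying set depends on the measure, on \<open>E\<close> and on \<open>X\<close>, so it is not a type. Normed spaces
  are therefore records with an explicit carrier, and the geometric properties are defined once
  for such records. A Banach space given by a type class enters via \<open>type_nspace\<close>.
\<close>

record 'v nspace =
  vcarrier :: "'v set"
  vzero :: 'v
  vadd :: "'v \<Rightarrow> 'v \<Rightarrow> 'v"
  vscale :: "real \<Rightarrow> 'v \<Rightarrow> 'v"
  vnorm :: "'v \<Rightarrow> real"

definition type_nspace :: "'a::real_normed_vector nspace" where
  "type_nspace = \<lparr>vcarrier = UNIV, vzero = 0, vadd = (+), vscale = (*\<^sub>R), vnorm = norm\<rparr>"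

text \<open>
  The library's \<open>Metric_space\<close> wants nonnegativity and symmetry off the carrier too, hence the
  default value.
\<close>

definition vdist :: "'v nspace \<Rightarrow> 'v \<Rightarrow> 'v \<Rightarrow> real" where
  "vdist V x y = (if x \<in> vcarrier V \<and> y \<in> vcarrier V
     then vnorm V (vadd V x (vscale V (-1) y)) else 0)"

locale real_normed_nspace =
  fixes V :: "'v nspace"
  assumes zero_closed: "vzero V \<in> vcarrier V"
    and add_closed: "\<lbrakk>x \<in> vcarrier V; y \<in> vcarrier V\<rbrakk> \<Longrightarrow> vadd V x y \<in> vcarrier V"
    and scale_closed: "x \<in> vcarrier V \<Longrightarrow> vscale V a x \<in> vcarrier V"
    and add_assoc: "\<lbrakk>x \<in> vcarrier V; y \<in> vcarrier V; z \<in> vcarrier V\<rbrakk>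
      \<Longrightarrow> vadd V (vadd V x y) z = vadd V x (vadd V y z)"
    and add_commute: "\<lbrakk>x \<in> vcarrier V; y \<in> vcarrier V\<rbrakk> \<Longrightarrow> vadd V x y = vadd V y x"
    and add_zero: "x \<in> vcarrier V \<Longrightarrow> vadd V (vzero V) x = x"
    and add_inverse: "x \<in> vcarrier V \<Longrightarrow> vadd V x (vscale V (-1) x) = vzero V"
    and scale_add_right: "\<lbrakk>x \<in> vcarrier V; y \<in> vcarrier V\<rbrakk>
      \<Longrightarrow> vscale V a (vadd V x y) = vadd V (vscale V a x) (vscale V a y)"
    and scale_add_left: "x \<in> vcarrier V
      \<Longrightarrow> vscale V (a + b) x = vadd V (vscale V a x) (vscale V b x)"
    and scale_scale: "x \<in> vcarrier V \<Longrightarrow> vscale V a (vscale V b x) = vscale V (a * b) x"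
    and scale_one: "x \<in> vcarrier V \<Longrightarrow> vscale V 1 x = x"
    and norm_ge_zero: "x \<in> vcarrier V \<Longrightarrow> 0 \<le> vnorm V x"
    and norm_eq_zero: "x \<in> vcarrier V \<Longrightarrow> vnorm V x = 0 \<longleftrightarrow> x = vzero V"
    and norm_triangle: "\<lbrakk>x \<in> vcarrier V; y \<in> vcarrier V\<rbrakk>
      \<Longrightarrow> vnorm V (vadd V x y) \<le> vnorm V x + vnorm V y"
    and norm_scale: "x \<in> vcarrier V \<Longrightarrow> vnorm V (vscale V a x) = \<bar>a\<bar> * vnorm V x"

lemma (in real_normed_nspace) Metric_space_vdist: "Metric_space (vcarrier V) (vdist V)"
proof
  define D where "D x y = vadd V x (vscale V (-1) y)" for x y
  have D: "D x y \<in> vcarrier V" if "x \<in> vcarrier V" "y \<in> vcarrier V" for x y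
    using that by (simp add: D_def add_closed scale_closed)
  have d: "vdist V x y = vnorm V (D x y)" if "x \<in> vcarrier V" "y \<in> vcarrier V" for x y
    using that by (simp add: vdist_def D_def)
  have cancel: "vadd V (D x y) y = x" if "x \<in> vcarrier V" "y \<in> vcarrier V" for x y
  proof -
    have "vadd V (D x y) y = vadd V x (vadd V (vscale V (-1) y) y)"
      using that by (simp add: D_def add_assoc scale_closed)
    also have "\<dots> = x"
      using that by (metis add_commute add_inverse add_zero scale_closed zero_closed)
    finally show ?thesis .
  qed
  show "0 \<le> vdist V x y" for x y
    using norm_ge_zero[OF D[of x y]] by (simp add: vdist_def D_def)
  have "vscale V (-1) (D x y) = D y x" if "x \<in> vcarrier V" "y \<in> vcarrier V" for x y
    using that add_commute[of y "vscale V (-1) x"]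
    by (simp add: D_def scale_add_right scale_scale scale_closed scale_one)
  then have "vnorm V (D y x) = vnorm V (D x y)" if "x \<in> vcarrier V" "y \<in> vcarrier V" for x y
    using that norm_scale[OF D[of x y], of "-1"] by simp
  then show "vdist V x y = vdist V y x" for x y
    by (simp add: vdist_def D_def)
  show "vdist V x y = 0 \<longleftrightarrow> x = y" if "x \<in> vcarrier V" "y \<in> vcarrier V" for x y
  proof -
    have "D x x = vzero V"
      using that by (simp add: D_def add_inverse)
    moreover have "x = y" if "D x y = vzero V"
      using cancel[of x y] that \<open>x \<in> vcarrier V\<close> \<open>y \<in> vcarrier V\<close> by (simp add: add_zero)
    ultimately show ?thesis
      using that by (auto simp: d D norm_eq_zero)
  qed
  show "vdist V x z \<le> vdist V x y + vdist V y z"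
    if "x \<in> vcarrier V" "y \<in> vcarrier V" "z \<in> vcarrier V" for x y z
  proof -
    have "vadd V (D x y) (D y z) = vadd V (vadd V (D x y) y) (vscale V (-1) z)"
      using that by (simp add: D_def[of y z] add_assoc D scale_closed)
    then have "D x z = vadd V (D x y) (D y z)"
      using that by (simp add: cancel D_def[of x z])
    then show ?thesis
      using that norm_triangle[OF D[of x y] D[of y z]] by (simp add: d)
  qed
qed

text \<open>Banach spaces are understood to be different from \<open>{0}\<close>.\<close>

locale banach_nspace = real_normed_nspace +
  assumes nontrivial: "vcarrier V \<noteq> {vzero V}"
    and complete: "Metric_space.mcomplete (vcarrier V) (vdist V)"


definition unit_ball :: "'v nspace \<Rightarrow> 'v set" where
  "unit_ball V = {x \<in> vcarrier V. vnorm V x \<le> 1}"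

definition unit_sphere :: "'v nspace \<Rightarrow> 'v set" where
  "unit_sphere V = {x \<in> vcarrier V. vnorm V x = 1}"

definition norm_closure :: "'v nspace \<Rightarrow> 'v set \<Rightarrow> 'v set" where
  "norm_closure V A = Metric_space.mtopology (vcarrier V) (vdist V) closure_of A"

definition vconvex :: "'v nspace \<Rightarrow> 'v set \<Rightarrow> bool" where
  "vconvex V C \<longleftrightarrow> C \<subseteq> vcarrier V \<and>
     (\<forall>x\<in>C. \<forall>y\<in>C. \<forall>u\<ge>0. \<forall>v\<ge>0. u + v = 1 \<longrightarrow> vadd V (vscale V u x) (vscale V v y) \<in> C)"

definition closed_convex_hull :: "'v nspace \<Rightarrow> 'v set \<Rightarrow> 'v set" where
  "closed_convex_hull V A = norm_closure V (vconvex V hull A)"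

text \<open>
  Functionals are total functions on the ambient type; only their values on the carrier matter.
\<close>

definition dual :: "'v nspace \<Rightarrow> ('v \<Rightarrow> real) set" where
  "dual V = {\<phi>.
     (\<forall>x\<in>vcarrier V. \<forall>y\<in>vcarrier V. \<phi> (vadd V x y) = \<phi> x + \<phi> y) \<and>
     (\<forall>a. \<forall>x\<in>vcarrier V. \<phi> (vscale V a x) = a * \<phi> x) \<and>
     (\<exists>K. \<forall>x\<in>vcarrier V. \<bar>\<phi> x\<bar> \<le> K * vnorm V x)}"

definition dual_norm :: "'v nspace \<Rightarrow> ('v \<Rightarrow> real) \<Rightarrow> real" where
  "dual_norm V \<phi> = (SUP x\<in>unit_ball V. \<bar>\<phi> x\<bar>)"

definition weak_topology :: "'v nspace \<Rightarrow> 'v topology" where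
  "weak_topology V =
     topology_generated_by {{x \<in> vcarrier V. \<phi> x \<in> W} | \<phi> W. \<phi> \<in> dual V \<and> open W}"

definition is_slice :: "'v nspace \<Rightarrow> 'v set \<Rightarrow> bool" where
  "is_slice V T \<longleftrightarrow> (\<exists>\<phi> \<alpha>. \<phi> \<in> dual V \<and> dual_norm V \<phi> = 1 \<and> \<alpha> > 0 \<and>
     T = {x \<in> unit_ball V. \<phi> x > 1 - \<alpha>})"

definition DD2P :: "'v nspace \<Rightarrow> bool" where
  "DD2P V \<longleftrightarrow> (\<forall>U. openin (subtopology (weak_topology V) (unit_ball V)) U \<and> U \<noteq> {} \<longrightarrow>
     (\<forall>x \<in> U \<inter> unit_sphere V. \<forall>\<epsilon>>0. \<exists>y\<in>U. vdist V x y \<ge> 2 - \<epsilon>))"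

definition DLD2P :: "'v nspace \<Rightarrow> bool" where
  "DLD2P V \<longleftrightarrow> (\<forall>T. is_slice V T \<longrightarrow>
     (\<forall>x \<in> T \<inter> unit_sphere V. \<forall>\<epsilon>>0. \<exists>y\<in>T. vdist V x y \<ge> 2 - \<epsilon>))"

definition Delta :: "'v nspace \<Rightarrow> real \<Rightarrow> 'v \<Rightarrow> 'v set" where
  "Delta V \<epsilon> x = {y \<in> unit_ball V. vdist V x y \<ge> 2 - \<epsilon>}"

definition Delta_points :: "'v nspace \<Rightarrow> 'v set" where
  "Delta_points V = {x \<in> unit_sphere V. \<forall>\<epsilon>>0. x \<in> closed_convex_hull V (Delta V \<epsilon> x)}"

definition convex_DLD2P :: "'v nspace \<Rightarrow> bool" where
  "convex_DLD2P V \<longleftrightarrow> unit_ball V = closed_convex_hull V (Delta_points V)"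


text \<open>
  \<open>ae_nspace M F N\<close> is the space \<open>F\<close> of functions modulo equality \<open>M\<close>-a.e.; \<open>N\<close> is the norm
  as a function of representatives. \<open>the_elem\<close> yields the common value of \<open>N\<close> on a class; in
  the spaces below \<open>N\<close> is constant on classes by the ideal property of the function space.
\<close>

definition ae_class :: "'s measure \<Rightarrow> ('s \<Rightarrow> 'b) set \<Rightarrow> ('s \<Rightarrow> 'b) \<Rightarrow> ('s \<Rightarrow> 'b) set" where
  "ae_class M F f = {g \<in> F. AE t in M. g t = f t}"

definition ae_nspace ::
    "'s measure \<Rightarrow> ('s \<Rightarrow> 'b::real_vector) set \<Rightarrow> (('s \<Rightarrow> 'b) \<Rightarrow> real) \<Rightarrow> ('s \<Rightarrow> 'b) set nspace" where
  "ae_nspace M F N = \<lparr>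
     vcarrier = ae_class M F ` F,
     vzero = ae_class M F (\<lambda>t. 0),
     vadd = (\<lambda>A B. {h \<in> F. \<exists>f\<in>A. \<exists>g\<in>B. AE t in M. h t = f t + g t}),
     vscale = (\<lambda>a A. {h \<in> F. \<exists>f\<in>A. AE t in M. h t = a *\<^sub>R f t}),
     vnorm = (\<lambda>A. the_elem (N ` A))\<rparr>"

locale koethe_function_space =
  fixes M :: "'s measure" and E :: "('s \<Rightarrow> real) set" and N :: "('s \<Rightarrow> real) \<Rightarrow> real"
  assumes measurable: "E \<subseteq> borel_measurable M"
    and banach: "banach_nspace (ae_nspace M E N)"
    and indicator_mem: "\<lbrakk>A \<in> sets M; emeasure M A < \<infinity>\<rbrakk> \<Longrightarrow> indicator A \<in> E"
    and locally_integrable: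
      "\<lbrakk>f \<in> E; A \<in> sets M; emeasure M A < \<infinity>\<rbrakk> \<Longrightarrow> set_integrable M A f"
    and ideal:
      "\<lbrakk>g \<in> borel_measurable M; f \<in> E; AE t in M. \<bar>g t\<bar> \<le> \<bar>f t\<bar>\<rbrakk> \<Longrightarrow> g \<in> E \<and> N g \<le> N f"

text \<open>
  The library's \<open>simple_function\<close> does not require a support of finite measure.
\<close>

definition simple_fun :: "'s measure \<Rightarrow> ('s \<Rightarrow> 'x::real_normed_vector) \<Rightarrow> bool" where
  "simple_fun M f \<longleftrightarrow> (\<exists>\<A>. finite \<A> \<and> disjoint \<A> \<and> \<A> \<subseteq> sets M \<and>
     (\<forall>A\<in>\<A>. emeasure M A < \<infinity> \<and> f constant_on A) \<and>
     (\<forall>t \<in> space M - \<Union>\<A>. f t = 0))"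

definition bochner_measurable :: "'s measure \<Rightarrow> ('s \<Rightarrow> 'x::real_normed_vector) \<Rightarrow> bool" where
  "bochner_measurable M f \<longleftrightarrow> (\<exists>s. (\<forall>n::nat. simple_fun M (s n)) \<and>
     (AE t in M. (\<lambda>n. norm (s n t - f t)) \<longlonglongrightarrow> 0))"

definition KB_funs :: "'s measure \<Rightarrow> ('s \<Rightarrow> real) set \<Rightarrow> ('s \<Rightarrow> 'x::real_normed_vector) set" where
  "KB_funs M E = {f. bochner_measurable M f \<and> (\<lambda>t. norm (f t)) \<in> E}"

definition koethe_bochner :: "'s measure \<Rightarrow> ('s \<Rightarrow> real) set \<Rightarrow> (('s \<Rightarrow> real) \<Rightarrow> real)
    \<Rightarrow> ('s \<Rightarrow> 'x::real_normed_vector) set nspace" where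
  "koethe_bochner M E N = ae_nspace M (KB_funs M E) (\<lambda>f. N (\<lambda>t. norm (f t)))"

definition simple_classes :: "'s measure \<Rightarrow> ('s \<Rightarrow> real) set
    \<Rightarrow> ('s \<Rightarrow> 'x::real_normed_vector) set set" where
  "simple_classes M E = ae_class M (KB_funs M E) ` {f. simple_fun M f}"


text \<open>Agreement with the library's notions on a type-class Banach space.\<close>

lemma type_nspace_simps [simp]:
  "vcarrier type_nspace = UNIV" "vzero type_nspace = 0" "vadd type_nspace = (+)"
  "vscale type_nspace = (*\<^sub>R)" "vnorm type_nspace = norm" "vdist type_nspace = dist"
  by (simp_all add: type_nspace_def vdist_def fun_eq_iff dist_norm)

lemma banach_type_nspace:
  assumes "(UNIV :: 'a::banach set) \<noteq> {0}"
  shows "banach_nspace (type_nspace :: 'a nspace)"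
proof
  show "Metric_space.mcomplete (vcarrier type_nspace) (vdist (type_nspace :: 'a nspace))"
    using complete_UNIV by (simp add: mcomplete_iff_complete)
qed (use assms in \<open>auto simp: algebra_simps norm_triangle_ineq\<close>)

lemma closed_convex_hull_type_nspace:
  "closed_convex_hull type_nspace A = closure (convex hull A)"
proof -
  have "vconvex (type_nspace :: 'a nspace) = convex"
    by (auto simp: vconvex_def convex_def fun_eq_iff)
  then show ?thesis
    by (simp add: closed_convex_hull_def norm_closure_def)
qed

lemma dual_type_nspace:
  fixes \<phi> :: "'a::real_normed_vector \<Rightarrow> real"
  shows "\<phi> \<in> dual type_nspace \<longleftrightarrow> bounded_linear \<phi>"
proof
  assume "\<phi> \<in> dual type_nspace"
  then obtain K where "\<And>x y. \<phi> (x + y) = \<phi> x + \<phi> y" "\<And>a x. \<phi> (a *\<^sub>R x) = a * \<phi> x"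
      "\<And>x. \<bar>\<phi> x\<bar> \<le> K * norm x"
    by (auto simp: dual_def)
  then show "bounded_linear \<phi>"
    by (intro bounded_linear_intro[of \<phi> K]) (simp_all add: mult.commute)
next
  assume "bounded_linear \<phi>"
  then interpret bounded_linear \<phi> .
  show "\<phi> \<in> dual type_nspace"
    using bounded by (auto simp: dual_def add scale mult.commute)
qed

end

theory Submission
  imports Defs
begin

text \<open>
  By density, a norm-one function may be replaced by a norm-one simple function
  \<open>g = (\<Sum>i. c\<^sub>i \<chi>\<^bsub>A\<^sub>i\<^esub> e\<^sub>i)\<close> with \<open>c\<^sub>i > 0\<close> and unit vectors \<open>e\<^sub>i\<close>. Replacing each \<open>e\<^sub>i\<close> by
  some \<open>y\<^sub>i\<close> of the unit ball with \<open>\<parallel>e\<^sub>i - y\<^sub>i\<parallel> \<ge> 2 - \<epsilon>\<close> gives a function in the unit ball at distance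
  at least \<open>2 - \<epsilon>\<close> from \<open>g\<close>, by the ideal property of \<open>E\<close>. For (a) and (b), a functional \<open>\<phi>\<close> on
  \<open>E(X)\<close> induces the functionals \<open>x \<mapsto> \<phi>(c\<^sub>i \<chi>\<^bsub>A\<^sub>i\<^esub> x)\<close> on \<open>X\<close>, so the \<open>y\<^sub>i\<close> can be chosen such that
  \<open>\<phi>\<close> drops only a little; weak neighbourhoods need finitely many functionals at a time, slices only
  one. For (c), if all \<open>e\<^sub>i\<close> are \<open>\<Delta>\<close>-points, then so is \<open>g\<close>; and since \<open>g\<close> is affine and
  continuous in each \<open>e\<^sub>i\<close> separately, closed convex hulls can be formed coordinatewise.
\<close>

section \<open>Normed spaces with explicit carrier\<close>

context real_normed_nspace
begin

lemma mem_norm_closure: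
  "x \<in> norm_closure V A \<longleftrightarrow>
     x \<in> vcarrier V \<and> (\<forall>r>0. \<exists>y\<in>A. y \<in> vcarrier V \<and> vdist V x y < r)"
proof -
  interpret Metric_space "vcarrier V" "vdist V"
    by (rule Metric_space_vdist)
  show ?thesis
    by (auto simp: norm_closure_def metric_closure_of)
qed

lemma norm_closure_mono: "A \<subseteq> B \<Longrightarrow> norm_closure V A \<subseteq> norm_closure V B"
  by (simp add: norm_closure_def closure_of_mono)

lemma norm_closure_idem: "norm_closure V (norm_closure V A) = norm_closure V A"
  by (simp add: norm_closure_def)

lemma vdist_convex_combination_le:
  assumes "x \<in> vcarrier V" "y \<in> vcarrier V" "x' \<in> vcarrier V" "y' \<in> vcarrier V"
    and "0 \<le> u" "0 \<le> v"
  shows "vdist V (vadd V (vscale V u x) (vscale V v y)) (vadd V (vscale V u x') (vscale V v y'))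
           \<le> u * vdist V x x' + v * vdist V y y'"
proof -
  \<comment> \<open>Completes \<open>add_assoc\<close> and \<open>add_commute\<close> to permutative
    rewriting, under which both sides below become the same sum of four vectors.\<close>
  have left_commute: "vadd V a (vadd V b c) = vadd V b (vadd V a c)"
    if "a \<in> vcarrier V" "b \<in> vcarrier V" "c \<in> vcarrier V" for a b c
    using that by (metis add_assoc add_commute)
  have "vadd V (vadd V (vscale V u x) (vscale V v y))
          (vscale V (-1) (vadd V (vscale V u x') (vscale V v y')))
        = vadd V (vscale V u (vadd V x (vscale V (-1) x')))
                 (vscale V v (vadd V y (vscale V (-1) y')))"
    using assms by (simp add: add_closed scale_closed scale_add_right scale_scale add_assoc
        left_commute add_commute)
  then show ?thesis
    using assms norm_triangle[of "vscale V u (vadd V x (vscale V (-1) x'))"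
        "vscale V v (vadd V y (vscale V (-1) y'))"]
    by (simp add: vdist_def add_closed scale_closed norm_scale)
qed

text \<open>Approximants of \<open>x\<close> and \<open>y\<close> in \<open>C\<close>, combined with
  the same weights, approximate the combination.\<close>

lemma vconvex_norm_closure:
  assumes "vconvex V C"
  shows "vconvex V (norm_closure V C)"
  unfolding vconvex_def
proof (intro conjI ballI allI impI)
  show "norm_closure V C \<subseteq> vcarrier V"
    by (auto simp: mem_norm_closure)
next
  fix x y and u v :: real
  assume x: "x \<in> norm_closure V C" and y: "y \<in> norm_closure V C"
    and uv: "0 \<le> u" "0 \<le> v" "u + v = 1"
  show "vadd V (vscale V u x) (vscale V v y) \<in> norm_closure V C"
    unfolding mem_norm_closure
  proof (intro conjI allI impI)
    show "vadd V (vscale V u x) (vscale V v y) \<in> vcarrier V"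
      using x y by (simp add: mem_norm_closure add_closed scale_closed)
    fix r :: real
    assume "r > 0"
    then obtain x' y' where x': "x' \<in> C" "x' \<in> vcarrier V" "vdist V x x' < r"
      and y': "y' \<in> C" "y' \<in> vcarrier V" "vdist V y y' < r"
      using x y unfolding mem_norm_closure by metis
    have "vdist V (vadd V (vscale V u x) (vscale V v y)) (vadd V (vscale V u x') (vscale V v y'))
        \<le> u * vdist V x x' + v * vdist V y y'"
      using x y x' y' uv by (intro vdist_convex_combination_le) (auto simp: mem_norm_closure)
    \<comment> \<open>The inequality stays strict because the weights sum to 1 and so are not both
      zero.\<close>
    also have "\<dots> < r"
      using convex_bound_lt[OF x'(3) y'(3) uv] by simp
    finally show "\<exists>z\<in>C. z \<in> vcarrier V \<and> vdist V (vadd V (vscale V u x) (vscale V v y)) z < r"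
      using assms x' y' uv
      by (intro bexI[of _ "vadd V (vscale V u x') (vscale V v y')"])
        (auto simp: vconvex_def add_closed scale_closed)
  qed
qed

text \<open>\<open>vconvex\<close> includes lying in the carrier. For \<open>A\<close> inside the
  carrier, the carrier is a convex superset; with no such superset the hull would be an empty
  intersection, that is \<open>UNIV\<close>.\<close>

lemma vconvex_hull:
  assumes "A \<subseteq> vcarrier V"
  shows "vconvex V (vconvex V hull A)"
proof -
  have "vconvex V (vcarrier V)"
    by (simp add: vconvex_def add_closed scale_closed)
  then have "vconvex V hull A \<subseteq> vcarrier V"
    using assms by (intro hull_minimal)
  then show ?thesis
    by (force simp: vconvex_def hull_def)
qed

lemma vconvex_closed_convex_hull:
  "A \<subseteq> vcarrier V \<Longrightarrow> vconvex V (closed_convex_hull V A)"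
  by (simp add: closed_convex_hull_def vconvex_norm_closure vconvex_hull)

lemma norm_closure_closed_convex_hull:
  "norm_closure V (closed_convex_hull V A) = closed_convex_hull V A"
  by (simp add: closed_convex_hull_def norm_closure_idem)

lemma closed_convex_hull_superset: "A \<subseteq> vcarrier V \<Longrightarrow> A \<subseteq> closed_convex_hull V A"
  unfolding closed_convex_hull_def norm_closure_def
  using closure_of_subset[of "vconvex V hull A" "Metric_space.mtopology (vcarrier V) (vdist V)"]
    hull_subset[of A "vconvex V"] vconvex_hull[of A]
    Metric_space.topspace_mtopology[OF Metric_space_vdist]
  by (auto simp: vconvex_def)

lemma closed_convex_hull_minimal:
  assumes "A \<subseteq> C" "vconvex V C" "norm_closure V C = C"
  shows "closed_convex_hull V A \<subseteq> C"
  unfolding closed_convex_hull_def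
  using norm_closure_mono[OF hull_minimal[where S = "vconvex V", OF assms(1,2)]] assms(3) by simp

lemma vdist_zero: "x \<in> vcarrier V \<Longrightarrow> vdist V x (vzero V) = vnorm V x"
  \<comment> \<open>Symmetry of the distance puts \<open>vzero V\<close> first, where
    \<open>add_zero\<close> applies and leaves the norm of \<open>vscale V (-1) x\<close>.\<close>
  by (metis Metric_space.commute Metric_space_vdist add_zero mult_1 norm_scale
      abs_minus_cancel abs_one scale_closed vdist_def zero_closed)

lemma vconvex_unit_ball: "vconvex V (unit_ball V)"
  unfolding vconvex_def
proof (intro conjI ballI allI impI)
  fix x y and u v :: real
  assume x: "x \<in> unit_ball V" and y: "y \<in> unit_ball V" and uv: "0 \<le> u" "0 \<le> v" "u + v = 1"
  have "vnorm V (vadd V (vscale V u x) (vscale V v y)) \<le> u * vnorm V x + v * vnorm V y"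
    using norm_triangle[of "vscale V u x" "vscale V v y"] x y uv
    by (simp add: unit_ball_def scale_closed norm_scale)
  also have "\<dots> \<le> 1"
    using x y uv by (intro convex_bound_le) (auto simp: unit_ball_def)
  finally show "vadd V (vscale V u x) (vscale V v y) \<in> unit_ball V"
    using x y by (simp add: unit_ball_def add_closed scale_closed)
qed (auto simp: unit_ball_def)

lemma norm_closure_unit_ball: "norm_closure V (unit_ball V) = unit_ball V"
proof -
  interpret Metric_space "vcarrier V" "vdist V"
    by (rule Metric_space_vdist)
  have "unit_ball V = mcball (vzero V) 1"
    using zero_closed vdist_zero by (auto simp: unit_ball_def mcball_def commute)
  then show ?thesis
    by (simp add: norm_closure_def closure_of_closedin)
qed

text \<open>A vector \<open>x = r w\<close> with \<open>w\<close> on the sphere and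
  \<open>0 \<le> r \<le> 1\<close> lies on the segment from \<open>-w\<close> to \<open>w\<close>,
  with weights \<open>(1 - r) / 2\<close> and \<open>(1 + r) / 2\<close>. For \<open>x = 0\<close>
  any \<open>w\<close> will do, provided the sphere is nonempty.\<close>

lemma unit_ball_subset_if_unit_sphere_subset:
  assumes "vconvex V C" "unit_sphere V \<subseteq> C" "unit_sphere V \<noteq> {}"
  shows "unit_ball V \<subseteq> C"
proof
  fix x assume x: "x \<in> unit_ball V"
  define r where "r = vnorm V x"
  have r: "0 \<le> r" "r \<le> 1"
    using x by (auto simp: r_def unit_ball_def norm_ge_zero)
  obtain w where w: "w \<in> unit_sphere V" "x = vscale V r w"
  proof (cases "r = 0")
    case True
    obtain w where "w \<in> unit_sphere V"
      using assms(3) by auto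
    moreover have "x = vscale V r w"
      using x True \<open>w \<in> unit_sphere V\<close>
      by (metis (no_types, lifting) abs_zero mem_Collect_eq mult_zero_left norm_eq_zero norm_scale
          r_def scale_closed unit_ball_def unit_sphere_def)
    ultimately show ?thesis
      using that by blast
  next
    case False
    then show ?thesis
      using x r by (intro that[of "vscale V (1 / r) x"])
        (auto simp: unit_sphere_def unit_ball_def r_def scale_closed norm_scale scale_scale scale_one)
  qed
  have "vscale V (-1) w \<in> unit_sphere V"
    using w by (simp add: unit_sphere_def scale_closed norm_scale)
  then have "vadd V (vscale V ((1 + r) / 2) w) (vscale V ((1 - r) / 2) (vscale V (-1) w)) \<in> C"
    using assms(1,2) w(1) r subsetD[OF assms(2)] by (auto simp: vconvex_def simp flip: add_divide_distrib)
  moreover have "vadd V (vscale V ((1 + r) / 2) w) (vscale V ((1 - r) / 2) (vscale V (-1) w))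
      = vscale V ((1 + r) / 2 + (1 - r) / 2 * (-1)) w"
    using w by (simp only: unit_sphere_def scale_add_left scale_scale mem_Collect_eq)
  moreover have "(1 + r) / 2 + (1 - r) / 2 * (-1) = r"
    by (simp add: field_simps)
  ultimately show "x \<in> C"
    using w by simp
qed

end

section \<open>Functionals and weak neighbourhoods\<close>

lemma uminus_dual:
  assumes "\<phi> \<in> dual V"
  shows "(\<lambda>x. - \<phi> x) \<in> dual V"
  using assms by (simp add: dual_def)

lemma openin_weak_topology_vimage:
  assumes "\<phi> \<in> dual V" "open W"
  shows "openin (weak_topology V) {x \<in> vcarrier V. \<phi> x \<in> W}"
  unfolding weak_topology_def
  by (rule topology_generated_by_Basis, intro CollectI exI[of _ \<phi>] exI[of _ W]) (use assms in simp)

lemma openin_weak_halfspaces: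
  assumes "finite F" "F \<subseteq> dual V"
  shows "openin (weak_topology V) {x \<in> vcarrier V. \<forall>\<phi>\<in>F. \<phi> x > a \<phi>}"
  using assms
proof (induction F)
  case empty
  \<comment> \<open>The zero functional exhibits the whole carrier as a subbasic weakly open
    set.\<close>
  have "(\<lambda>x. 0) \<in> dual V"
    by (auto simp: dual_def intro: exI[of _ 0])
  then show ?case
    using openin_weak_topology_vimage[of "\<lambda>x. 0" V UNIV] by simp
next
  case (insert \<phi> F)
  have "openin (weak_topology V) {x \<in> vcarrier V. \<phi> x \<in> {a \<phi><..}}"
    using insert.prems by (intro openin_weak_topology_vimage) auto
  then have "openin (weak_topology V)
      ({x \<in> vcarrier V. \<phi> x \<in> {a \<phi><..}} \<inter> {x \<in> vcarrier V. \<forall>\<phi>\<in>F. \<phi> x > a \<phi>})"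
    using insert by (intro openin_Int) auto
  also have "{x \<in> vcarrier V. \<phi> x \<in> {a \<phi><..}} \<inter> {x \<in> vcarrier V. \<forall>\<phi>\<in>F. \<phi> x > a \<phi>}
      = {x \<in> vcarrier V. \<forall>\<phi>\<in>insert \<phi> F. \<phi> x > a \<phi>}"
    by auto
  finally show ?case .
qed

text \<open>A two-sided bound on \<open>\<phi>\<close> is a pair of one-sided bounds on
  \<open>\<phi>\<close> and \<open>- \<phi>\<close>. Working with halfspaces only means that
  functionals merely have to be kept from dropping.\<close>

lemma weak_neighbourhood_halfspaces:
  assumes "openin (weak_topology V) U" "x \<in> U"
  obtains F \<delta> where "finite F" "F \<subseteq> dual V" "\<delta> > 0"
    "{y \<in> vcarrier V. \<forall>\<phi>\<in>F. \<phi> y > \<phi> x - \<delta>} \<subseteq> U"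
proof -
  have "generate_topology_on {{x \<in> vcarrier V. \<phi> x \<in> W} | \<phi> W. \<phi> \<in> dual V \<and> open W} U"
    using assms(1) by (simp add: weak_topology_def openin_topology_generated_by_iff)
  then have "\<exists>F \<delta>. finite F \<and> F \<subseteq> dual V \<and> \<delta> > 0 \<and>
      {y \<in> vcarrier V. \<forall>\<phi>\<in>F. \<phi> y > \<phi> x - \<delta>} \<subseteq> U"
    using assms(2)
  proof (induction rule: generate_topology_on.induct)
    case Empty
    then show ?case by simp
  next
    case (Int a b)
    then obtain F \<delta> G \<eta> where F: "finite F" "F \<subseteq> dual V" "\<delta> > 0"
      "{y \<in> vcarrier V. \<forall>\<phi>\<in>F. \<phi> y > \<phi> x - \<delta>} \<subseteq> a"
      and G: "finite G" "G \<subseteq> dual V" "\<eta> > 0"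
      "{y \<in> vcarrier V. \<forall>\<phi>\<in>G. \<phi> y > \<phi> x - \<eta>} \<subseteq> b"
      by (elim IntE) blast
    have "{y \<in> vcarrier V. \<forall>\<phi>\<in>F \<union> G. \<phi> y > \<phi> x - min \<delta> \<eta>} \<subseteq> a \<inter> b"
    proof
      fix y assume y: "y \<in> {y \<in> vcarrier V. \<forall>\<phi>\<in>F \<union> G. \<phi> y > \<phi> x - min \<delta> \<eta>}"
      then have "\<phi> y > \<phi> x - \<delta>" if "\<phi> \<in> F" for \<phi>
        using that by (smt (verit) UnI1 mem_Collect_eq)
      moreover have "\<phi> y > \<phi> x - \<eta>" if "\<phi> \<in> G" for \<phi>
        using that y by (smt (verit) UnI2 mem_Collect_eq)
      ultimately show "y \<in> a \<inter> b"
        using y F(4) G(4) by blast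
    qed
    then show ?case
      using F(1-3) G(1-3) by (intro exI[of _ "F \<union> G"] exI[of _ "min \<delta> \<eta>"]) simp
  next
    case (UN K)
    then obtain k where k: "k \<in> K" "x \<in> k"
      by blast
    obtain F \<delta> where "finite F" "F \<subseteq> dual V" "\<delta> > 0"
      "{y \<in> vcarrier V. \<forall>\<phi>\<in>F. \<phi> y > \<phi> x - \<delta>} \<subseteq> k"
      using UN.IH[OF k] by blast
    with k(1) show ?case
      by (intro exI[of _ F] exI[of _ \<delta>]) blast
  next
    case (Basis s)
    then obtain \<phi> W where \<phi>: "s = {x \<in> vcarrier V. \<phi> x \<in> W}" "\<phi> \<in> dual V" "open W" "\<phi> x \<in> W"
      by clarsimp
    then obtain \<delta> where "\<delta> > 0" "ball (\<phi> x) \<delta> \<subseteq> W"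
      using open_contains_ball by blast
    moreover have "\<phi> y \<in> ball (\<phi> x) \<delta>" if "\<phi> y > \<phi> x - \<delta>" "- \<phi> y > - \<phi> x - \<delta>" for y
      using that by (auto simp: dist_real_def)
    ultimately show ?case
      using \<phi> uminus_dual[OF \<phi>(2)]
      by (intro exI[of _ "{\<phi>, \<lambda>x. - \<phi> x}"] exI[of _ \<delta>]) auto
  qed
  then show ?thesis
    using that by blast
qed

text \<open>Norm continuity of finitely many functionals at once; it permits replacing a function by
  a nearby simple one.\<close>

lemma (in real_normed_nspace) ex_dual_neighbourhood:
  assumes "finite \<Phi>" "\<Phi> \<subseteq> dual V" "x \<in> vcarrier V" "\<delta> > 0"
  shows "\<exists>r>0. \<forall>y\<in>vcarrier V. vdist V x y < r \<longrightarrow> (\<forall>\<phi>\<in>\<Phi>. \<phi> y > \<phi> x - \<delta>)"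
  using assms(1,2)
proof (induction \<Phi>)
  case (insert \<phi> \<Phi>)
  then obtain r where r: "r > 0"
    "\<And>y. \<lbrakk>y \<in> vcarrier V; vdist V x y < r\<rbrakk> \<Longrightarrow> \<forall>\<phi>\<in>\<Phi>. \<phi> y > \<phi> x - \<delta>"
    by auto
  have "\<phi> \<in> dual V"
    using insert.prems by simp
  then obtain K where K: "\<And>z. z \<in> vcarrier V \<Longrightarrow> \<bar>\<phi> z\<bar> \<le> K * vnorm V z"
    unfolding dual_def by blast
  \<comment> \<open>\<open>K\<close> need not be positive, so \<open>\<bar>K\<bar> + 1\<close>
    serves as the bound and as a safe divisor.\<close>
  have "\<phi> y > \<phi> x - \<delta>" if y: "y \<in> vcarrier V" "vdist V x y < \<delta> / (\<bar>K\<bar> + 1)" for y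
  proof -
    define z where "z = vadd V x (vscale V (-1) y)"
    have z: "z \<in> vcarrier V" "vnorm V z = vdist V x y"
      using assms(3) y by (auto simp: z_def vdist_def add_closed scale_closed)
    have "\<phi> z = \<phi> x - \<phi> y"
      using insert.prems assms(3) y(1) by (simp add: z_def dual_def scale_closed)
    moreover have "K * vnorm V z \<le> (\<bar>K\<bar> + 1) * vdist V x y"
      using z norm_ge_zero[OF z(1)] by (intro mult_mono) auto
    moreover have "(\<bar>K\<bar> + 1) * vdist V x y < \<delta>"
      using y(2) by (simp add: field_simps)
    ultimately show ?thesis
      using K[OF z(1)] by linarith
  qed
  then show ?case
    using r assms(4) by (intro exI[of _ "min r (\<delta> / (\<bar>K\<bar> + 1))"]) auto
qed (auto intro: exI[of _ 1])

section \<open>Diametral properties in terms of functionals\<close>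

text \<open>Weakly open sets around \<open>x\<close> shrink to finitely many halfspaces with a
  common slack \<open>\<delta>\<close>, and conversely such halfspaces are weakly open.\<close>

lemma DD2P_iff:
  "DD2P V \<longleftrightarrow> (\<forall>x\<in>unit_sphere V. \<forall>F \<delta> \<epsilon>. finite F \<and> F \<subseteq> dual V \<and> \<delta> > 0 \<and> \<epsilon> > 0 \<longrightarrow>
     (\<exists>y\<in>unit_ball V. vdist V x y \<ge> 2 - \<epsilon> \<and> (\<forall>\<phi>\<in>F. \<phi> y > \<phi> x - \<delta>)))" (is "?L = ?R")
proof
  assume L: ?L
  show ?R
  proof (intro ballI allI impI, elim conjE)
    fix x F and \<delta> \<epsilon> :: real
    assume x: "x \<in> unit_sphere V" and F: "finite F" "F \<subseteq> dual V" and "\<delta> > 0" "\<epsilon> > 0"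
    define U where "U = {y \<in> vcarrier V. \<forall>\<phi>\<in>F. \<phi> y > \<phi> x - \<delta>} \<inter> unit_ball V"
    have "openin (subtopology (weak_topology V) (unit_ball V)) U"
      using openin_weak_halfspaces[OF F, of "\<lambda>\<phi>. \<phi> x - \<delta>"]
      by (auto simp: U_def openin_subtopology)
    moreover have "x \<in> U"
      using x \<open>\<delta> > 0\<close> by (auto simp: U_def unit_sphere_def unit_ball_def)
    ultimately obtain y where "y \<in> U" "vdist V x y \<ge> 2 - \<epsilon>"
      using L x \<open>\<epsilon> > 0\<close> unfolding DD2P_def by (metis IntI empty_iff)
    then show "\<exists>y\<in>unit_ball V. vdist V x y \<ge> 2 - \<epsilon> \<and> (\<forall>\<phi>\<in>F. \<phi> y > \<phi> x - \<delta>)"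
      by (auto simp: U_def)
  qed
next
  assume R: ?R
  show ?L
    unfolding DD2P_def
  proof (intro allI impI ballI)
    fix U x and \<epsilon> :: real
    assume U: "openin (subtopology (weak_topology V) (unit_ball V)) U \<and> U \<noteq> {}"
      and x: "x \<in> U \<inter> unit_sphere V" and "\<epsilon> > 0"
    obtain O' where O': "openin (weak_topology V) O'" "U = O' \<inter> unit_ball V"
      using U by (auto simp: openin_subtopology)
    then obtain F \<delta> where "finite F" "F \<subseteq> dual V" "\<delta> > 0"
      and sub: "{y \<in> vcarrier V. \<forall>\<phi>\<in>F. \<phi> y > \<phi> x - \<delta>} \<subseteq> O'"
      using weak_neighbourhood_halfspaces[of V O' x] x by blast
    then obtain y where "y \<in> unit_ball V" "vdist V x y \<ge> 2 - \<epsilon>" "\<forall>\<phi>\<in>F. \<phi> y > \<phi> x - \<delta>"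
      using R x \<open>\<epsilon> > 0\<close> by blast
    then show "\<exists>y\<in>U. vdist V x y \<ge> 2 - \<epsilon>"
      using sub O' by (auto simp: unit_ball_def)
  qed
qed

text \<open>A slice through \<open>x\<close> consists of the points of the ball where
  \<open>\<phi>\<close> exceeds \<open>\<phi> x - \<delta>\<close> with
  \<open>\<delta> = \<phi> x - (1 - \<alpha>)\<close>, which is positive because \<open>x\<close>
  lies in the slice.\<close>

lemma DLD2PI:
  assumes "\<And>x \<phi> \<delta> \<epsilon>. \<lbrakk>x \<in> unit_sphere V; \<phi> \<in> dual V; \<delta> > 0; \<epsilon> > 0\<rbrakk> \<Longrightarrow>
     \<exists>y\<in>unit_ball V. vdist V x y \<ge> 2 - \<epsilon> \<and> \<phi> y > \<phi> x - \<delta>"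
  shows "DLD2P V"
  unfolding DLD2P_def
proof (intro allI impI ballI)
  fix T x and \<epsilon> :: real
  assume "is_slice V T" and x: "x \<in> T \<inter> unit_sphere V" and "\<epsilon> > 0"
  then obtain \<phi> \<alpha> where \<phi>: "\<phi> \<in> dual V" "T = {x \<in> unit_ball V. \<phi> x > 1 - \<alpha>}"
    by (auto simp: is_slice_def)
  then show "\<exists>y\<in>T. vdist V x y \<ge> 2 - \<epsilon>"
    using assms[of x \<phi> "\<phi> x - (1 - \<alpha>)" \<epsilon>] x \<open>\<epsilon> > 0\<close> by auto
qed

text \<open>Rescaling a nonzero \<open>x\<close> to norm one turns the supremum over the unit ball
  into that of the quotients defining \<open>onorm\<close>. Functionals on \<open>X\<close> can then
  be normalised by \<open>onorm\<close>.\<close>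

lemma dual_norm_type_nspace:
  fixes \<phi> :: "'a::real_normed_vector \<Rightarrow> real"
  assumes "bounded_linear \<phi>"
  shows "dual_norm type_nspace \<phi> = onorm \<phi>"
proof (rule antisym)
  interpret bounded_linear \<phi> by fact
  have le: "\<bar>\<phi> x\<bar> \<le> onorm \<phi>" if "norm x \<le> 1" for x
    using onorm[OF assms, of x] mult_left_mono[OF that onorm_pos_le[OF assms]] by simp
  show "dual_norm type_nspace \<phi> \<le> onorm \<phi>"
    unfolding dual_norm_def
    by (rule cSUP_least) (auto simp: unit_ball_def le intro: exI[of _ 0])
  have ub: "\<bar>\<phi> x\<bar> \<le> dual_norm type_nspace \<phi>" if "norm x \<le> 1" for x
    unfolding dual_norm_def
    by (rule cSUP_upper) (use that le in \<open>auto simp: unit_ball_def bdd_above_def\<close>)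
  show "onorm \<phi> \<le> dual_norm type_nspace \<phi>"
  proof (rule onorm_bound)
    show "0 \<le> dual_norm type_nspace \<phi>"
      using ub[of 0] by simp
    show "norm (\<phi> x) \<le> dual_norm type_nspace \<phi> * norm x" for x
    proof (cases "x = 0")
      case False
      then show ?thesis
        using ub[of "x /\<^sub>R norm x"] by (simp add: scale abs_mult divide_simps mult.commute)
    qed (simp add: zero)
  qed
qed

text \<open>For \<open>\<phi> = 0\<close> there is no slice to use, but then \<open>- x\<close> is a diametral partner of \<open>x\<close>.\<close>

lemma DLD2P_type_nspaceD:
  fixes x :: "'a::real_normed_vector" and \<phi> :: "'a \<Rightarrow> real"
  assumes "DLD2P (type_nspace :: 'a nspace)" "norm x = 1" "bounded_linear \<phi>" "\<delta> > 0" "\<epsilon> > 0"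
  shows "\<exists>y. norm y \<le> 1 \<and> dist x y \<ge> 2 - \<epsilon> \<and> \<phi> y > \<phi> x - \<delta>"
proof (cases "\<phi> = (\<lambda>x. 0)")
  case True
  have "dist x (- x) = norm (2 *\<^sub>R x)"
    by (simp add: dist_norm flip: scaleR_2)
  then show ?thesis
    using assms(2,4,5) unfolding True by (intro exI[of _ "- x"]) simp
next
  case False
  define s where "s = onorm \<phi>"
  have s: "s > 0"
    using False onorm_pos_lt[OF assms(3)] by (auto simp: s_def)
  interpret bounded_linear \<phi> by fact
  define \<psi> where "\<psi> = (\<lambda>x. (1 / s) *\<^sub>R \<phi> x)"
  have \<psi>: "bounded_linear \<psi>"
    unfolding \<psi>_def by (intro bounded_linear_scaleR_right[THEN bounded_linear_compose] assms)
  have "onorm \<psi> = 1"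
    unfolding \<psi>_def using s by (subst onorm_scaleR[OF assms(3)]) (simp add: s_def)
  \<comment> \<open>Solved from \<open>1 - \<alpha> = (\<phi> x - \<delta>) / s\<close>, so that the
    slice of the normalised functional is exactly the region where
    \<open>\<phi> y > \<phi> x - \<delta>\<close>.\<close>
  define \<alpha> where "\<alpha> = 1 - (\<phi> x - \<delta>) / s"
  have "\<phi> x \<le> s"
    using onorm[OF assms(3), of x] assms(2) by (simp add: s_def)
  then have "\<alpha> > 0"
    using s \<open>\<delta> > 0\<close> by (simp add: \<alpha>_def field_simps)
  then have "is_slice type_nspace {y \<in> unit_ball type_nspace. \<psi> y > 1 - \<alpha>}"
    using \<psi> \<open>onorm \<psi> = 1\<close>
    by (auto simp: is_slice_def dual_type_nspace dual_norm_type_nspace intro!: exI[of _ \<psi>] exI[of _ \<alpha>])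
  moreover have slice_iff: "\<psi> y > 1 - \<alpha> \<longleftrightarrow> \<phi> y > \<phi> x - \<delta>" for y
    using s by (simp add: \<psi>_def \<alpha>_def divide_simps)
  ultimately obtain y where "y \<in> {y \<in> unit_ball type_nspace. \<psi> y > 1 - \<alpha>}" "dist x y \<ge> 2 - \<epsilon>"
    using assms unfolding DLD2P_def
    by (force simp: unit_sphere_def unit_ball_def)
  then show ?thesis
    by (auto simp: slice_iff unit_ball_def)
qed

section \<open>Spaces of functions modulo equality almost everywhere\<close>

lemma vcarrier_ae_nspace: "vcarrier (ae_nspace M F N) = ae_class M F ` F"
  by (simp add: ae_nspace_def)

text \<open>Shared by \<open>E\<close> and \<open>KB_funs M E\<close>: operations on classes are
  computed on representatives, and \<open>N_cong\<close> makes \<open>the_elem\<close> in the norm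
  well defined.\<close>

locale ae_function_space =
  fixes M :: "'s measure" and F :: "('s \<Rightarrow> 'b::real_vector) set" and N :: "('s \<Rightarrow> 'b) \<Rightarrow> real"
  assumes zero_mem: "(\<lambda>t. 0) \<in> F"
    and add_mem: "\<lbrakk>f \<in> F; g \<in> F\<rbrakk> \<Longrightarrow> (\<lambda>t. f t + g t) \<in> F"
    and scale_mem: "f \<in> F \<Longrightarrow> (\<lambda>t. a *\<^sub>R f t) \<in> F"
    and N_cong: "\<lbrakk>f \<in> F; g \<in> F; AE t in M. f t = g t\<rbrakk> \<Longrightarrow> N f = N g"
begin

lemma class_eq_iff:
  assumes "f \<in> F" "g \<in> F"
  shows "ae_class M F f = ae_class M F g \<longleftrightarrow> (AE t in M. f t = g t)"
proof
  assume "ae_class M F f = ae_class M F g"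
  moreover have "f \<in> ae_class M F f"
    using assms by (simp add: ae_class_def)
  ultimately show "AE t in M. f t = g t"
    by (simp add: ae_class_def)
next
  assume fg: "AE t in M. f t = g t"
  have "(AE t in M. h t = f t) \<longleftrightarrow> (AE t in M. h t = g t)" for h
    using fg by (auto elim!: AE_mp)
  then show "ae_class M F f = ae_class M F g"
    by (simp add: ae_class_def)
qed

lemma vadd_class:
  assumes "f \<in> F" "g \<in> F"
  shows "vadd (ae_nspace M F N) (ae_class M F f) (ae_class M F g) = ae_class M F (\<lambda>t. f t + g t)"
proof -
  have "(\<exists>f'\<in>ae_class M F f. \<exists>g'\<in>ae_class M F g. AE t in M. h t = f' t + g' t) \<longleftrightarrow>
      (AE t in M. h t = f t + g t)" for h
  proof
    assume "\<exists>f'\<in>ae_class M F f. \<exists>g'\<in>ae_class M F g. AE t in M. h t = f' t + g' t"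
    then obtain f' g' where "AE t in M. f' t = f t" "AE t in M. g' t = g t"
      "AE t in M. h t = f' t + g' t"
      by (auto simp: ae_class_def)
    then show "AE t in M. h t = f t + g t"
      by eventually_elim simp
  next
    assume "AE t in M. h t = f t + g t"
    then show "\<exists>f'\<in>ae_class M F f. \<exists>g'\<in>ae_class M F g. AE t in M. h t = f' t + g' t"
      using assms by (intro bexI[of _ f] bexI[of _ g]) (auto simp: ae_class_def)
  qed
  then show ?thesis
    by (auto simp: ae_nspace_def ae_class_def)
qed

lemma vscale_class:
  assumes "f \<in> F"
  shows "vscale (ae_nspace M F N) a (ae_class M F f) = ae_class M F (\<lambda>t. a *\<^sub>R f t)"
proof -
  have "(\<exists>f'\<in>ae_class M F f. AE t in M. h t = a *\<^sub>R f' t) \<longleftrightarrow> (AE t in M. h t = a *\<^sub>R f t)" for h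
  proof
    assume "\<exists>f'\<in>ae_class M F f. AE t in M. h t = a *\<^sub>R f' t"
    then obtain f' where "AE t in M. f' t = f t" "AE t in M. h t = a *\<^sub>R f' t"
      by (auto simp: ae_class_def)
    then show "AE t in M. h t = a *\<^sub>R f t"
      by eventually_elim simp
  next
    assume "AE t in M. h t = a *\<^sub>R f t"
    then show "\<exists>f'\<in>ae_class M F f. AE t in M. h t = a *\<^sub>R f' t"
      using assms by (intro bexI[of _ f]) (auto simp: ae_class_def)
  qed
  then show ?thesis
    by (auto simp: ae_nspace_def ae_class_def)
qed

lemma vzero_class: "vzero (ae_nspace M F N) = ae_class M F (\<lambda>t. 0)"
  by (simp add: ae_nspace_def)

lemma vnorm_class:
  assumes "f \<in> F"
  shows "vnorm (ae_nspace M F N) (ae_class M F f) = N f"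
proof -
  have "f \<in> ae_class M F f"
    using assms by (simp add: ae_class_def)
  moreover have "N g = N f" if "g \<in> ae_class M F f" for g
    using that by (intro N_cong assms) (simp_all add: ae_class_def)
  ultimately have "N ` ae_class M F f = {N f}"
    by blast
  then show ?thesis
    by (simp add: ae_nspace_def)
qed

lemma class_mem: "f \<in> F \<Longrightarrow> ae_class M F f \<in> vcarrier (ae_nspace M F N)"
  by (simp add: vcarrier_ae_nspace)

lemma uminus_mem: "f \<in> F \<Longrightarrow> (\<lambda>t. - f t) \<in> F"
  using scale_mem[of f "-1"] by simp

lemma diff_mem: "\<lbrakk>f \<in> F; g \<in> F\<rbrakk> \<Longrightarrow> (\<lambda>t. f t - g t) \<in> F"
  using add_mem[of f "\<lambda>t. - g t"] uminus_mem[of g] by simp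

lemma vdist_class:
  assumes "f \<in> F" "g \<in> F"
  shows "vdist (ae_nspace M F N) (ae_class M F f) (ae_class M F g) = N (\<lambda>t. f t - g t)"
  using assms by (simp add: vdist_def class_mem vscale_class vadd_class vnorm_class diff_mem
      uminus_mem)

end

text \<open>The norm axioms on representatives. For \<open>E\<close> they are read off from the
  given Banach space; for vector-valued functions they are verified and yield the normed space of
  classes.\<close>

locale ae_normed_space = ae_function_space +
  assumes N_triangle: "\<lbrakk>f \<in> F; g \<in> F\<rbrakk> \<Longrightarrow> N (\<lambda>t. f t + g t) \<le> N f + N g"
    and N_scale: "f \<in> F \<Longrightarrow> N (\<lambda>t. a *\<^sub>R f t) = \<bar>a\<bar> * N f"
    and N_eq_0D: "\<lbrakk>f \<in> F; N f = 0\<rbrakk> \<Longrightarrow> AE t in M. f t = 0"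
begin

lemma N_zero: "N (\<lambda>t. 0) = 0"
  using N_scale[OF zero_mem, of 0] by simp

text \<open>The triangle inequality and homogeneity give
  \<open>0 = N (f - f) \<le> 2 * N f\<close>.\<close>

lemma N_nonneg: "f \<in> F \<Longrightarrow> 0 \<le> N f"
  using N_triangle[of f "\<lambda>t. (-1) *\<^sub>R f t"] N_scale[of f "-1"] scale_mem[of f "-1"] N_zero
  by simp

lemma real_normed_nspace: "real_normed_nspace (ae_nspace M F N)"
proof (unfold_locales, goal_cases)
  \<comment> \<open>Goals 12 and 13 are \<open>norm_ge_zero\<close> and \<open>norm_eq_zero\<close>;
    the remaining ones follow by computing with representatives.\<close>
  case 12
  then show ?case
    by (auto simp: vcarrier_ae_nspace vnorm_class N_nonneg)
next
  case (13 x)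
  then obtain f where "f \<in> F" "x = ae_class M F f"
    by (auto simp: vcarrier_ae_nspace)
  then show ?case
    using N_eq_0D[of f] N_cong[of f "\<lambda>t. 0"] zero_mem N_zero
    by (auto simp: vnorm_class vzero_class class_eq_iff)
qed (auto simp: vcarrier_ae_nspace vzero_class vadd_class vscale_class vnorm_class zero_mem add_mem
      scale_mem uminus_mem algebra_simps N_triangle[simplified add.commute] N_triangle N_scale)

end

section \<open>Koethe function spaces\<close>

context koethe_function_space
begin

text \<open>The Banach space axioms speak about classes: they provide some \<open>h\<close> in
  \<open>E\<close> equal a.e. to the sum or multiple. The ideal property then places the measurable
  function itself in \<open>E\<close>.\<close>

lemma E_add_scale:
  shows E_add: "\<lbrakk>f \<in> E; g \<in> E\<rbrakk> \<Longrightarrow> (\<lambda>t. f t + g t) \<in> E"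
    and E_scale: "f \<in> E \<Longrightarrow> (\<lambda>t. a * f t) \<in> E"
proof -
  interpret B: banach_nspace "ae_nspace M E N"
    by (rule banach)
  have class_self: "f \<in> ae_class M E f" if "f \<in> E" for f
    using that by (simp add: ae_class_def)
  have meas: "f \<in> borel_measurable M" if "f \<in> E" for f
    using that measurable by auto
  show "(\<lambda>t. f t + g t) \<in> E" if fg: "f \<in> E" "g \<in> E"
  proof -
    have "vadd (ae_nspace M E N) (ae_class M E f) (ae_class M E g) \<in> vcarrier (ae_nspace M E N)"
      using fg by (intro B.add_closed) (simp_all add: vcarrier_ae_nspace)
    then obtain h where "h \<in> E"
      "vadd (ae_nspace M E N) (ae_class M E f) (ae_class M E g) = ae_class M E h"
      by (auto simp: vcarrier_ae_nspace)
    with class_self have "h \<in> vadd (ae_nspace M E N) (ae_class M E f) (ae_class M E g)"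
      by simp
    then obtain f' g' where "AE t in M. f' t = f t" "AE t in M. g' t = g t"
      "AE t in M. h t = f' t + g' t"
      by (auto simp: ae_nspace_def ae_class_def)
    then have "AE t in M. \<bar>f t + g t\<bar> \<le> \<bar>h t\<bar>"
      by eventually_elim simp
    then show ?thesis
      using ideal[OF _ \<open>h \<in> E\<close>] meas[OF fg(1)] meas[OF fg(2)] by simp
  qed
  show "(\<lambda>t. a * f t) \<in> E" if f: "f \<in> E"
  proof -
    have "vscale (ae_nspace M E N) a (ae_class M E f) \<in> vcarrier (ae_nspace M E N)"
      using f by (intro B.scale_closed) (simp add: vcarrier_ae_nspace)
    then obtain h where "h \<in> E" "vscale (ae_nspace M E N) a (ae_class M E f) = ae_class M E h"
      by (auto simp: vcarrier_ae_nspace)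
    with class_self have "h \<in> vscale (ae_nspace M E N) a (ae_class M E f)"
      by simp
    then obtain f' where "AE t in M. f' t = f t" "AE t in M. h t = a * f' t"
      by (auto simp: ae_nspace_def ae_class_def)
    then have "AE t in M. \<bar>a * f t\<bar> \<le> \<bar>h t\<bar>"
      by eventually_elim simp
    then show ?thesis
      using ideal[OF _ \<open>h \<in> E\<close>] meas[OF f] by simp
  qed
qed

lemma E_zero: "(\<lambda>t. 0) \<in> E"
  using indicator_mem[of "{}"] by (simp add: indicator_def[abs_def])

lemma N_mono:
  assumes "f \<in> E" "g \<in> E" "AE t in M. \<bar>g t\<bar> \<le> \<bar>f t\<bar>"
  shows "N g \<le> N f"
  using assms ideal measurable by auto

lemma N_E_cong:
  assumes "f \<in> E" "g \<in> E" "AE t in M. \<bar>f t\<bar> = \<bar>g t\<bar>"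
  shows "N f = N g"
  using assms(3) by (intro antisym N_mono assms(1,2); eventually_elim) simp_all

sublocale ae_function_space M E N
proof
  show "N f = N g" if "f \<in> E" "g \<in> E" "AE t in M. f t = g t" for f g
    using that(3) by (intro N_E_cong that(1,2); eventually_elim) simp
qed (simp_all add: E_zero E_add E_scale)

sublocale ae_normed_space M E N
proof -
  interpret B: banach_nspace "ae_nspace M E N"
    by (rule banach)
  show "ae_normed_space M E N"
  proof
    fix f g :: "'s \<Rightarrow> real" and a :: real
    assume f: "f \<in> E"
    show "N (\<lambda>t. a *\<^sub>R f t) = \<bar>a\<bar> * N f"
      using B.norm_scale[OF class_mem[OF f], of a] f
      by (simp add: vscale_class vnorm_class scale_mem[simplified])
    show "AE t in M. f t = 0" if "N f = 0"
      using B.norm_eq_zero[OF class_mem[OF f]] f that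
      by (simp add: vnorm_class vzero_class class_eq_iff zero_mem)
    assume g: "g \<in> E"
    show "N (\<lambda>t. f t + g t) \<le> N f + N g"
      using B.norm_triangle[OF class_mem[OF f] class_mem[OF g]] f g
      by (simp add: vadd_class vnorm_class add_mem)
  qed
qed

text \<open>If every set of finite measure were null, \<sigma>-finiteness would make \<open>M\<close> and hence \<open>E\<close> trivial.\<close>

lemma ex_finite_nonnull_set:
  assumes "sigma_finite_measure M"
  obtains A where "A \<in> sets M" "emeasure M A < \<infinity>" "emeasure M A \<noteq> 0"
proof -
  interpret B: banach_nspace "ae_nspace M E N"
    by (rule banach)
  interpret sigma_finite_measure M
    by fact
  obtain A :: "nat \<Rightarrow> 's set" where A: "range A \<subseteq> sets M" "(\<Union>i. A i) = space M"
    "\<And>i. emeasure M (A i) \<noteq> \<infinity>"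
    using sigma_finite by blast
  have "\<exists>i. emeasure M (A i) \<noteq> 0"
  proof (rule ccontr)
    assume "\<not> ?thesis"
    then have "(\<Union>i. A i) \<in> null_sets M"
      using A(1) by (intro null_sets_UN) auto
    then have "AE t in M. P t" for P
      using A(2) by (auto intro: AE_I')
    then have "ae_class M E f = ae_class M E (\<lambda>t. 0)" if "f \<in> E" for f
      using that by (simp add: class_eq_iff zero_mem)
    then have "ae_class M E ` E = (\<lambda>f. ae_class M E (\<lambda>t. 0)) ` E"
      by (rule image_cong[OF refl])
    then have "vcarrier (ae_nspace M E N) = {vzero (ae_nspace M E N)}"
      using zero_mem by (auto simp: vcarrier_ae_nspace vzero_class image_constant_conv)
    then show False
      using B.nontrivial by simp
  qed
  then show thesis
    using A that by (metis infinity_ennreal_def less_top range_subsetD)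
qed

end

section \<open>Simple and Bochner-measurable functions\<close>

text \<open>The link to the library, from which closure under pointwise operations is
  obtained.\<close>

lemma simple_fun_iff_simple_bochner_integrable:
  "simple_fun M f \<longleftrightarrow> Bochner_Integration.simple_bochner_integrable M f"
proof
  assume "simple_fun M f"
  then obtain \<A> where \<A>: "finite \<A>" "\<A> \<subseteq> sets M" "\<And>A. A \<in> \<A> \<Longrightarrow> emeasure M A < \<infinity>"
    "\<And>A. A \<in> \<A> \<Longrightarrow> f constant_on A" "\<And>t. t \<in> space M - \<Union>\<A> \<Longrightarrow> f t = 0"
    unfolding simple_fun_def by blast
  have Un: "\<Union>\<A> \<in> sets M"
    using \<A> by (auto intro: sets.finite_Union)
  have "finite (f ` A)" if "A \<in> \<A>" for A
    using \<A>(4)[OF that] by (auto simp: constant_on_def intro: finite_subset[of _ "{_}"])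
  then have "finite (insert 0 (\<Union>A\<in>\<A>. f ` A))"
    using \<A>(1) by simp
  moreover have "f ` space M \<subseteq> insert 0 (\<Union>A\<in>\<A>. f ` A)"
    using \<A>(5) by blast
  ultimately have "finite (f ` space M)"
    by (rule rev_finite_subset)
  moreover have "f -` {c} \<inter> space M \<in> sets M" for c
  proof -
    \<comment> \<open>The sets in \<open>\<A>\<close> need not be level sets: a level set collects
      those on which \<open>f\<close> is constantly \<open>c\<close>, and for \<open>c = 0\<close>
      also the complement of their union.\<close>
    have "f -` {c} \<inter> space M
        = \<Union>{A \<in> \<A>. A \<subseteq> f -` {c}} \<union> (if c = 0 then space M - \<Union>\<A> else {})"
    proof (intro equalityI subsetI)
      fix t assume t: "t \<in> f -` {c} \<inter> space M"
      show "t \<in> \<Union>{A \<in> \<A>. A \<subseteq> f -` {c}} \<union> (if c = 0 then space M - \<Union>\<A> else {})"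
      proof (cases "t \<in> \<Union>\<A>")
        case True
        then obtain A where "A \<in> \<A>" "t \<in> A"
          by auto
        moreover have "A \<subseteq> f -` {c}"
          using \<A>(4)[OF \<open>A \<in> \<A>\<close>] \<open>t \<in> A\<close> t by (auto simp: constant_on_def)
        ultimately show ?thesis
          by auto
      next
        case False
        then show ?thesis
          using t \<A>(5)[of t] by auto
      qed
    next
      fix t assume "t \<in> \<Union>{A \<in> \<A>. A \<subseteq> f -` {c}} \<union> (if c = 0 then space M - \<Union>\<A> else {})"
      then show "t \<in> f -` {c} \<inter> space M"
        using \<A>(5)[of t] subsetD[OF \<A>(2), THEN sets.sets_into_space]
        by (auto split: if_splits)
    qed
    then show ?thesis
      using \<A>(1,2) Un by (auto intro!: sets.finite_Union sets.Un)
  qed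
  ultimately have sf: "simple_function M f"
    by (simp add: simple_function_def)
  have "emeasure M {t \<in> space M. f t \<noteq> 0} \<le> emeasure M (\<Union>\<A>)"
    using \<A>(5) Un by (intro emeasure_mono) auto
  also have "\<dots> \<le> (\<Sum>A\<in>\<A>. emeasure M A)"
    using emeasure_subadditive_finite[of \<A> "\<lambda>A. A" M] \<A>(1,2) by auto
  also have "\<dots> < \<infinity>"
    using \<A>(1,3) by (simp add: less_top)
  finally show "Bochner_Integration.simple_bochner_integrable M f"
    using sf by (auto intro: Bochner_Integration.simple_bochner_integrable.intros)
next
  assume "Bochner_Integration.simple_bochner_integrable M f"
  then have f: "simple_function M f" "emeasure M {t \<in> space M. f t \<noteq> 0} < \<infinity>"
    by (auto elim!: Bochner_Integration.simple_bochner_integrable.cases simp: less_top)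
  have supp: "{t \<in> space M. f t \<noteq> 0} \<in> sets M"
    using simple_functionD(2)[OF f(1), of "- {0}"] by (simp add: vimage_def Int_def conj_commute)
  \<comment> \<open>The nonzero level sets are disjoint and have finite measure as subsets of the
    support.\<close>
  define \<A> where "\<A> = (\<lambda>v. f -` {v} \<inter> space M) ` (f ` space M - {0})"
  have "emeasure M A < \<infinity>" if "A \<in> \<A>" for A
  proof -
    have "emeasure M A \<le> emeasure M {t \<in> space M. f t \<noteq> 0}"
      using that by (intro emeasure_mono supp) (auto simp: \<A>_def)
    then show ?thesis
      using f(2) by simp
  qed
  moreover have "finite \<A>" "\<A> \<subseteq> sets M"
    using simple_functionD[OF f(1)] by (auto simp: \<A>_def)
  moreover have "disjoint \<A>"
    by (auto simp: \<A>_def disjoint_def)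
  ultimately show "simple_fun M f"
    unfolding simple_fun_def
    by (intro exI[of _ \<A>]) (auto simp: \<A>_def constant_on_def)
qed

lemma simple_fun_compose2:
  assumes "simple_fun M f" "simple_fun M g" "p 0 0 = 0"
  shows "simple_fun M (\<lambda>t. p (f t) (g t))"
  using assms simple_bochner_integrable_compose2[of p]
  by (simp add: simple_fun_iff_simple_bochner_integrable)

lemma simple_fun_compose:
  assumes "simple_fun M f" "p 0 = 0"
  shows "simple_fun M (\<lambda>t. p (f t))"
  using simple_fun_compose2[OF assms(1,1), of "\<lambda>x y. p x"] assms(2) by simp

lemma simple_funD:
  assumes "simple_fun M f"
  shows "simple_function M f" "finite (f ` space M)" "{t \<in> space M. f t \<noteq> 0} \<in> sets M"
    "emeasure M {t \<in> space M. f t \<noteq> 0} < \<infinity>"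
proof -
  show sf: "simple_function M f" and "emeasure M {t \<in> space M. f t \<noteq> 0} < \<infinity>"
    using assms unfolding simple_fun_iff_simple_bochner_integrable
    by (auto elim!: Bochner_Integration.simple_bochner_integrable.cases simp: less_top)
  show "finite (f ` space M)"
    using simple_functionD[OF sf] by auto
  show "{t \<in> space M. f t \<noteq> 0} \<in> sets M"
    using simple_functionD(2)[OF sf, of "- {0}"] by (simp add: vimage_def Int_def conj_commute)
qed

section \<open>Bochner measurability\<close>

lemma bochner_measurable_simple: "simple_fun M f \<Longrightarrow> bochner_measurable M f"
  by (auto simp: bochner_measurable_def intro: exI[of _ "\<lambda>n. f"])

lemma bochner_measurable_add:
  assumes "bochner_measurable M f" "bochner_measurable M g"
  shows "bochner_measurable M (\<lambda>t. f t + g t)"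
proof -
  obtain s r where s: "\<And>n. simple_fun M (s n)" "AE t in M. (\<lambda>n. norm (s n t - f t)) \<longlonglongrightarrow> 0"
    and r: "\<And>n. simple_fun M (r n)" "AE t in M. (\<lambda>n. norm (r n t - g t)) \<longlonglongrightarrow> 0"
    using assms unfolding bochner_measurable_def by blast
  have "AE t in M. (\<lambda>n. norm (s n t + r n t - (f t + g t))) \<longlonglongrightarrow> 0"
    using s(2) r(2)
  proof eventually_elim
    case (elim t)
    then have "(\<lambda>n. s n t) \<longlonglongrightarrow> f t" "(\<lambda>n. r n t) \<longlonglongrightarrow> g t"
      by (simp_all add: tendsto_norm_zero_iff LIM_zero_iff)
    then have "(\<lambda>n. s n t + r n t) \<longlonglongrightarrow> f t + g t"
      by (rule tendsto_add)
    then show ?case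
      by (simp add: tendsto_norm_zero_iff LIM_zero_iff)
  qed
  moreover have "simple_fun M (\<lambda>t. s n t + r n t)" for n
    using simple_fun_compose2[OF s(1) r(1), of "(+)"] by simp
  ultimately show ?thesis
    unfolding bochner_measurable_def by (intro exI[of _ "\<lambda>n t. s n t + r n t"]) simp
qed

lemma bochner_measurable_scaleR:
  assumes "bochner_measurable M f"
  shows "bochner_measurable M (\<lambda>t. a *\<^sub>R f t)"
proof -
  obtain s where s: "\<And>n. simple_fun M (s n)" "AE t in M. (\<lambda>n. norm (s n t - f t)) \<longlonglongrightarrow> 0"
    using assms unfolding bochner_measurable_def by blast
  have "AE t in M. (\<lambda>n. norm (a *\<^sub>R s n t - a *\<^sub>R f t)) \<longlonglongrightarrow> 0"
    using s(2)
  proof eventually_elim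
    case (elim t)
    then have "(\<lambda>n. a *\<^sub>R s n t) \<longlonglongrightarrow> a *\<^sub>R f t"
      by (intro tendsto_scaleR) (simp_all add: tendsto_norm_zero_iff LIM_zero_iff)
    then show ?case
      by (simp add: tendsto_norm_zero_iff LIM_zero_iff)
  qed
  moreover have "simple_fun M (\<lambda>t. a *\<^sub>R s n t)" for n
    using simple_fun_compose[OF s(1), of "(*\<^sub>R) a"] by simp
  ultimately show ?thesis
    unfolding bochner_measurable_def by (intro exI[of _ "\<lambda>n t. a *\<^sub>R s n t"]) simp
qed

text \<open>Preimages under \<open>f\<close> and \<open>g\<close> agree up to a null set, and
  completeness makes both measurable.\<close>

lemma (in complete_measure) borel_measurable_AE_cong:
  assumes "f \<in> borel_measurable M" "AE t in M. f t = g t"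
  shows "g \<in> borel_measurable M"
proof (rule measurableI)
  fix B :: "'b set" assume "B \<in> sets borel"
  show "g -` B \<inter> space M \<in> sets M"
  proof (rule in_sets_AE)
    show "AE t in M. t \<in> f -` B \<inter> space M \<longleftrightarrow> t \<in> g -` B \<inter> space M"
      using assms(2) by eventually_elim simp
  qed (use assms(1) \<open>B \<in> sets borel\<close> in \<open>auto intro: measurable_sets\<close>)
qed simp

lemma (in complete_measure) borel_measurable_norm_bochner:
  assumes "bochner_measurable M f"
  shows "(\<lambda>t. norm (f t)) \<in> borel_measurable M"
proof -
  obtain s where s: "\<And>n. simple_fun M (s n)" "AE t in M. (\<lambda>n. norm (s n t - f t)) \<longlonglongrightarrow> 0"
    using assms unfolding bochner_measurable_def by blast
  show ?thesis
  proof (rule borel_measurable_AE_cong)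
    \<comment> \<open>\<open>lim\<close> is total, so this function is measurable everywhere; off a
      null set the sequence converges to \<open>norm (f t)\<close>.\<close>
    show "(\<lambda>t. lim (\<lambda>n. norm (s n t))) \<in> borel_measurable M"
      using simple_funD(1)[OF simple_fun_compose[OF s(1), of norm]]
      by (intro borel_measurable_lim_metric borel_measurable_simple_function) simp
    show "AE t in M. lim (\<lambda>n. norm (s n t)) = norm (f t)"
      using s(2)
    proof eventually_elim
      case (elim t)
      then show ?case
        by (intro limI tendsto_norm) (simp add: tendsto_norm_zero_iff LIM_zero_iff)
    qed
  qed
qed

section \<open>Koethe--Bochner spaces\<close>

text \<open>The \<open>itself\<close> parameter fixes the type of the values, which occurs in none
  of \<open>M\<close>, \<open>E\<close> and \<open>N\<close>.\<close>

locale koethe_bochner_space =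
  koethe_function_space M E N + complete_measure M + sigma_finite_measure M
  for M :: "'s measure" and E and N +
  fixes X :: "'x::real_normed_vector itself"
begin

abbreviation F :: "('s \<Rightarrow> 'x) set" where
  "F \<equiv> KB_funs M E"

abbreviation KB :: "('s \<Rightarrow> 'x) set nspace" where
  "KB \<equiv> koethe_bochner M E N"

abbreviation cls :: "('s \<Rightarrow> 'x) \<Rightarrow> ('s \<Rightarrow> 'x) set" where
  "cls \<equiv> ae_class M F"

abbreviation bnorm :: "('s \<Rightarrow> 'x) \<Rightarrow> real" where
  "bnorm f \<equiv> N (\<lambda>t. norm (f t))"

lemma norm_mem: "f \<in> F \<Longrightarrow> (\<lambda>t. norm (f t)) \<in> E"
  by (simp add: KB_funs_def)

lemma bnorm_mono:
  assumes "f \<in> F" "g \<in> F" "AE t in M. norm (g t) \<le> norm (f t)"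
  shows "bnorm g \<le> bnorm f"
  using assms norm_mem by (intro N_mono) auto

sublocale KB: ae_normed_space M F bnorm
proof
  show "(\<lambda>t. 0) \<in> F"
    by (auto simp: KB_funs_def E_zero simple_fun_def intro!: bochner_measurable_simple exI[of _ "{}"])
  fix f g :: "'s \<Rightarrow> 'x" and a :: real
  assume f: "f \<in> F"
  have "bochner_measurable M (\<lambda>t. a *\<^sub>R f t)"
    using f by (simp add: KB_funs_def bochner_measurable_scaleR)
  then show "(\<lambda>t. a *\<^sub>R f t) \<in> F"
    using E_scale[OF norm_mem[OF f], of "\<bar>a\<bar>"] by (simp add: KB_funs_def)
  show "bnorm (\<lambda>t. a *\<^sub>R f t) = \<bar>a\<bar> * bnorm f"
    using N_scale[OF norm_mem[OF f], of "\<bar>a\<bar>"] by simp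
  show "AE t in M. f t = 0" if "bnorm f = 0"
    using N_eq_0D[OF norm_mem[OF f] that] by simp
  assume g: "g \<in> F"
  have bm: "bochner_measurable M (\<lambda>t. f t + g t)"
    using f g by (simp add: KB_funs_def bochner_measurable_add)
  \<comment> \<open>This function dominates \<open>norm (f t + g t)\<close>; the ideal property
    yields both membership and the triangle inequality.\<close>
  have "(\<lambda>t. norm (f t) + norm (g t)) \<in> E"
    using f g by (intro E_add norm_mem)
  then have *: "(\<lambda>t. norm (f t + g t)) \<in> E \<and>
      bnorm (\<lambda>t. f t + g t) \<le> N (\<lambda>t. norm (f t) + norm (g t))"
    by (intro ideal borel_measurable_norm_bochner bm) (auto intro: norm_triangle_ineq order_trans)
  then show "(\<lambda>t. f t + g t) \<in> F"
    using bm by (simp add: KB_funs_def)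
  show "bnorm (\<lambda>t. f t + g t) \<le> bnorm f + bnorm g"
    using * N_triangle[OF norm_mem[OF f] norm_mem[OF g]] by simp
  show "bnorm f = bnorm g" if "AE t in M. f t = g t"
    using that by (intro N_E_cong norm_mem f g; eventually_elim) simp
qed

sublocale KB: real_normed_nspace KB
  using KB.real_normed_nspace by (simp add: koethe_bochner_def)

lemmas KB_simps = KB.vadd_class[folded koethe_bochner_def] KB.vscale_class[folded koethe_bochner_def]
  KB.vnorm_class[folded koethe_bochner_def] KB.vdist_class[folded koethe_bochner_def]
  KB.class_mem[folded koethe_bochner_def]

lemma vcarrier_KB: "vcarrier KB = cls ` F"
  by (simp add: koethe_bochner_def vcarrier_ae_nspace)

text \<open>The norm is dominated by a constant multiple of the indicator of the support, a set of
  finite measure.\<close>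

lemma simple_fun_mem:
  fixes f :: "'s \<Rightarrow> 'x"
  assumes "simple_fun M f"
  shows "f \<in> F"
proof -
  define S where "S = {t \<in> space M. f t \<noteq> 0}"
  obtain c where c: "\<And>t. t \<in> space M \<Longrightarrow> norm (f t) \<le> c"
    using finite_imp_bounded[OF simple_funD(2)[OF assms]] by (auto simp: bounded_iff)
  have "(\<lambda>t. c * indicator S t) \<in> E"
    using simple_funD(3,4)[OF assms] by (intro E_scale indicator_mem) (auto simp: S_def)
  moreover have "AE t in M. \<bar>norm (f t)\<bar> \<le> \<bar>c * indicator S t\<bar>"
    using c by (intro AE_I2) (fastforce simp: S_def indicator_def)
  ultimately have "(\<lambda>t. norm (f t)) \<in> E"
    using borel_measurable_norm_bochner[OF bochner_measurable_simple[OF assms]] ideal by blast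
  then show ?thesis
    using assms by (simp add: KB_funs_def bochner_measurable_simple)
qed

end

section \<open>Simple functions with prescribed directions\<close>

context koethe_bochner_space
begin

lemma bnorm_cls: "f \<in> F \<Longrightarrow> vnorm KB (cls f) = bnorm f"
  by (rule KB_simps)

text \<open>
  For a simple function \<open>g\<close>, every simple function with at most the support of \<open>g\<close> which is
  constant where \<open>g\<close> is has the form \<open>rep g y\<close>; the factor \<open>norm (g t)\<close> makes \<open>y\<close> range over
  vectors of the unit ball of \<open>X\<close>, with \<open>g = rep g sgn\<close>.
\<close>

definition rep :: "('s \<Rightarrow> 'x) \<Rightarrow> ('x \<Rightarrow> 'x) \<Rightarrow> 's \<Rightarrow> 'x" where
  "rep g y = (\<lambda>t. norm (g t) *\<^sub>R y (g t))"

text \<open>The value 0 is left out since there the factor \<open>norm (g t)\<close> vanishes and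
  the choice of \<open>y\<close> has no effect.\<close>

definition vals :: "('s \<Rightarrow> 'x) \<Rightarrow> 'x set" where
  "vals g = g ` space M - {0}"

lemma finite_vals: "simple_fun M g \<Longrightarrow> finite (vals g)"
  by (simp add: vals_def simple_funD)

lemma rep_sgn: "rep g sgn = g"
proof
  show "rep g sgn t = g t" for t
    by (cases "g t = 0") (simp_all add: rep_def sgn_div_norm)
qed

lemma simple_fun_rep: "simple_fun M g \<Longrightarrow> simple_fun M (rep g y)"
  unfolding rep_def by (rule simple_fun_compose[where p = "\<lambda>v. norm v *\<^sub>R y v"]) simp_all

lemma rep_mem: "simple_fun M g \<Longrightarrow> rep g y \<in> F"
  by (simp add: simple_fun_mem simple_fun_rep)

lemma bnorm_rep_cong:
  assumes g: "simple_fun M g" and y: "\<And>v. v \<in> vals g \<Longrightarrow> norm (y v) = 1"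
  shows "bnorm (rep g y) = bnorm g"
proof (rule N_E_cong)
  show "AE t in M. \<bar>norm (rep g y t)\<bar> = \<bar>norm (g t)\<bar>"
  proof (rule AE_I2)
    fix t assume "t \<in> space M"
    then show "\<bar>norm (rep g y t)\<bar> = \<bar>norm (g t)\<bar>"
      using y[of "g t"] by (cases "g t = 0") (auto simp: rep_def vals_def)
  qed
qed (use g in \<open>auto intro: norm_mem rep_mem simple_fun_mem\<close>)

lemma bnorm_rep_le:
  assumes g: "simple_fun M g" and y: "\<And>v. v \<in> vals g \<Longrightarrow> norm (y v) \<le> 1"
  shows "bnorm (rep g y) \<le> bnorm g"
proof (rule bnorm_mono)
  show "AE t in M. norm (rep g y t) \<le> norm (g t)"
  proof (rule AE_I2)
    fix t assume "t \<in> space M"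
    then show "norm (rep g y t) \<le> norm (g t)"
      using y[of "g t"] by (cases "g t = 0") (auto simp: rep_def vals_def intro: mult_left_le)
  qed
qed (use g in \<open>auto intro: rep_mem simple_fun_mem\<close>)

lemma vdist_rep_eq:
  assumes "simple_fun M g"
  shows "vdist KB (cls (rep g y)) (cls (rep g z)) = bnorm (rep g (\<lambda>v. y v - z v))"
  using assms by (simp add: KB_simps rep_mem) (simp add: rep_def scaleR_diff_right)

text \<open>The difference is pointwise at least \<open>c * norm (g t)\<close> in norm; monotonicity
  of \<open>N\<close> and \<open>bnorm g = 1\<close> give the bound. So diametral directions produce
  diametral functions.\<close>

lemma vdist_rep_ge:
  assumes g: "simple_fun M g" "bnorm g = 1" and c: "\<And>v. v \<in> vals g \<Longrightarrow> c \<le> dist (y v) (z v)"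
  shows "c \<le> vdist KB (cls (rep g y)) (cls (rep g z))"
proof (cases "0 \<le> c")
  case True
  have gF: "g \<in> F"
    using g(1) by (rule simple_fun_mem)
  have "c = bnorm (\<lambda>t. c *\<^sub>R g t)"
    using KB.N_scale[OF gF, of c] g(2) True by simp
  also have "\<dots> \<le> bnorm (rep g (\<lambda>v. y v - z v))"
  proof (rule bnorm_mono)
    show "AE t in M. norm (c *\<^sub>R g t) \<le> norm (rep g (\<lambda>v. y v - z v) t)"
    proof (rule AE_I2)
      fix t assume "t \<in> space M"
      then show "norm (c *\<^sub>R g t) \<le> norm (rep g (\<lambda>v. y v - z v) t)"
        using c[of "g t"] True
        by (cases "g t = 0") (auto simp: rep_def vals_def dist_norm mult.commute)
    qed
  qed (use g gF in \<open>auto intro: rep_mem KB.scale_mem\<close>)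
  finally show ?thesis
    using g by (simp add: vdist_rep_eq)
next
  \<comment> \<open>For \<open>c = 2 - \<epsilon>\<close> with \<open>\<epsilon>\<close> large,
    \<open>c\<close> is negative and the claim follows from nonnegativity of the norm.\<close>
  case False
  then show ?thesis
    using KB.N_nonneg[OF rep_mem[OF g(1), of "\<lambda>v. y v - z v"]]
    unfolding vdist_rep_eq[OF g(1)] by linarith
qed

text \<open>The same pointwise comparison from above; it gives continuity of \<open>rep g y\<close>
  in \<open>y\<close>.\<close>

lemma vdist_rep_le:
  assumes g: "simple_fun M g" and "0 \<le> c" and c: "\<And>v. v \<in> vals g \<Longrightarrow> dist (y v) (z v) \<le> c"
  shows "vdist KB (cls (rep g y)) (cls (rep g z)) \<le> c * bnorm g"
proof -
  have gF: "g \<in> F"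
    using g(1) by (rule simple_fun_mem)
  have "bnorm (rep g (\<lambda>v. y v - z v)) \<le> bnorm (\<lambda>t. c *\<^sub>R g t)"
  proof (rule bnorm_mono)
    show "AE t in M. norm (rep g (\<lambda>v. y v - z v) t) \<le> norm (c *\<^sub>R g t)"
    proof (rule AE_I2)
      fix t assume "t \<in> space M"
      then show "norm (rep g (\<lambda>v. y v - z v) t) \<le> norm (c *\<^sub>R g t)"
        using c[of "g t"] \<open>0 \<le> c\<close>
        by (cases "g t = 0") (auto simp: rep_def vals_def dist_norm mult.commute)
    qed
  qed (use g gF in \<open>auto intro: rep_mem KB.scale_mem\<close>)
  also have "\<dots> = c * bnorm g"
    using KB.N_scale[OF gF, of c] \<open>0 \<le> c\<close> by simp
  finally show ?thesis
    using g by (simp add: vdist_rep_eq)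
qed

section \<open>Functionals on \<open>X\<close> induced by functionals on \<open>KB\<close>\<close>

text \<open>The summand of \<open>rep g y\<close> belonging to the value \<open>v\<close>, linear in
  the direction \<open>x\<close>. The factor \<open>norm v\<close> makes it zero for
  \<open>v = 0\<close>, hence simple for every \<open>v\<close>.\<close>

definition part :: "('s \<Rightarrow> 'x) \<Rightarrow> 'x \<Rightarrow> 'x \<Rightarrow> 's \<Rightarrow> 'x" where
  "part g v x = (\<lambda>t. if g t = v then norm v *\<^sub>R x else 0)"

lemma part_mem:
  assumes "simple_fun M g"
  shows "part g v x \<in> F"
proof -
  have "simple_fun M (\<lambda>t. if g t = v then norm v *\<^sub>R x else 0)"
    by (rule simple_fun_compose[OF assms, where p = "\<lambda>w. if w = v then norm v *\<^sub>R x else 0"]) simp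
  then show ?thesis
    by (simp add: part_def simple_fun_mem)
qed

text \<open>Boundedness comes from the pointwise domination of \<open>part g v x\<close> by
  \<open>norm x *\<^sub>R g\<close>.\<close>

lemma bounded_linear_part:
  assumes g: "simple_fun M g" and \<phi>: "\<phi> \<in> dual KB"
  shows "bounded_linear (\<lambda>x. \<phi> (cls (part g v x)))"
proof -
  obtain K where K: "\<And>z. z \<in> vcarrier KB \<Longrightarrow> \<bar>\<phi> z\<bar> \<le> K * vnorm KB z"
    using \<phi> unfolding dual_def by blast
  note mem = part_mem[OF g] simple_fun_mem[OF g]
  show ?thesis
  proof (rule bounded_linear_intro[where K = "\<bar>K\<bar> * bnorm g"])
    fix x y :: 'x and a :: real
    have "part g v (x + y) = (\<lambda>t. part g v x t + part g v y t)"
      by (auto simp: part_def scaleR_add_right)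
    then show "\<phi> (cls (part g v (x + y))) = \<phi> (cls (part g v x)) + \<phi> (cls (part g v y))"
      using \<phi> mem by (simp add: dual_def KB_simps flip: KB_simps(1))
    have "part g v (a *\<^sub>R x) = (\<lambda>t. a *\<^sub>R part g v x t)"
      by (auto simp: part_def)
    then show "\<phi> (cls (part g v (a *\<^sub>R x))) = a *\<^sub>R \<phi> (cls (part g v x))"
      using \<phi> mem by (simp add: dual_def KB_simps flip: KB_simps(2))
    have "bnorm (part g v x) \<le> bnorm (\<lambda>t. norm x *\<^sub>R g t)"
      using mem by (intro bnorm_mono KB.scale_mem AE_I2) (auto simp: part_def)
    also have "\<dots> = norm x * bnorm g"
      using KB.N_scale[OF mem(2), of "norm x"] by simp
    finally have le: "bnorm (part g v x) \<le> norm x * bnorm g" .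
    have "\<bar>\<phi> (cls (part g v x))\<bar> \<le> K * bnorm (part g v x)"
      using K[of "cls (part g v x)"] mem by (simp add: KB_simps)
    also have "\<dots> \<le> \<bar>K\<bar> * (norm x * bnorm g)"
      using le KB.N_nonneg[OF mem(1)] by (intro mult_mono) auto
    finally show "norm (\<phi> (cls (part g v x))) \<le> norm x * (\<bar>K\<bar> * bnorm g)"
      by (simp add: mult_ac)
  qed
qed

lemma dual_sum:
  assumes \<phi>: "\<phi> \<in> dual KB" and "finite I" "\<And>i. i \<in> I \<Longrightarrow> f i \<in> F"
  shows "(\<lambda>t. \<Sum>i\<in>I. f i t) \<in> F \<and> \<phi> (cls (\<lambda>t. \<Sum>i\<in>I. f i t)) = (\<Sum>i\<in>I. \<phi> (cls (f i)))"
  using assms(2,3)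
proof (induction I)
  case empty
  \<comment> \<open>That \<open>\<phi>\<close> vanishes at the zero class is obtained from
    homogeneity with factor 0.\<close>
  have "\<phi> (vscale KB 0 (cls (\<lambda>t. 0))) = 0 * \<phi> (cls (\<lambda>t. 0))"
    using \<phi> KB_simps(5)[OF KB.zero_mem] unfolding dual_def by blast
  then show ?case
    using KB.zero_mem by (simp add: KB_simps)
next
  case (insert i I)
  then have "\<phi> (vadd KB (cls (f i)) (cls (\<lambda>t. \<Sum>i\<in>I. f i t)))
      = \<phi> (cls (f i)) + (\<Sum>i\<in>I. \<phi> (cls (f i)))"
    using \<phi> by (simp add: dual_def KB_simps(5))
  then show ?case
    using insert by (simp add: KB_simps(1) KB.add_mem)
qed

text \<open>At each point only the summand with \<open>v = g t\<close> can be nonzero. The loss of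
  \<open>\<phi>\<close> under a change of directions is thereby the sum of the losses of the induced
  functionals.\<close>

lemma dual_rep:
  assumes g: "simple_fun M g" and \<phi>: "\<phi> \<in> dual KB"
  shows "\<phi> (cls (rep g y)) = (\<Sum>v\<in>vals g. \<phi> (cls (part g v (y v))))"
proof -
  note sum = dual_sum[OF \<phi> finite_vals[OF g], of "\<lambda>v. part g v (y v)", OF part_mem[OF g]]
  have "AE t in M. rep g y t = (\<Sum>v\<in>vals g. part g v (y v) t)"
  proof (rule AE_I2)
    fix t assume t: "t \<in> space M"
    have "(\<Sum>v\<in>vals g. part g v (y v) t)
        = (\<Sum>v\<in>vals g. if v = g t then norm (g t) *\<^sub>R y (g t) else 0)"
      by (intro sum.cong) (auto simp: part_def)
    also have "\<dots> = rep g y t"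
      using t finite_vals[OF g] by (auto simp: rep_def vals_def)
    finally show "rep g y t = (\<Sum>v\<in>vals g. part g v (y v) t)"
      by simp
  qed
  then have "cls (rep g y) = cls (\<lambda>t. \<Sum>v\<in>vals g. part g v (y v) t)"
    using sum rep_mem[OF g] by (simp add: KB.class_eq_iff)
  then show ?thesis
    using sum by simp
qed

section \<open>Transfer of the DD2P and the DLD2P\<close>

text \<open>A simple function \<open>k\<close> close to \<open>f\<close> has norm close to 1, so
  dividing by its norm moves it only a little further.\<close>

lemma ex_simple_near_sphere:
  assumes dense: "vcarrier KB \<subseteq> norm_closure KB (simple_classes M E)"
    and f: "f \<in> unit_sphere KB" and "r > 0"
  obtains g where "simple_fun M g" "bnorm g = 1" "vdist KB f (cls g) < r"
proof -
  obtain f' where f': "f' \<in> F" "f = cls f'" "bnorm f' = 1"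
    using f by (auto simp: unit_sphere_def vcarrier_KB bnorm_cls)
  \<comment> \<open>The error is paid twice, for approximating and for normalising, hence
    \<open>r / 2\<close>; the bound \<open>1 / 2\<close> keeps the norm of \<open>k\<close>
    positive.\<close>
  define s where "s = min (r / 2) (1 / 2)"
  have s: "s > 0" "s \<le> 1 / 2" "s \<le> r / 2"
    using \<open>r > 0\<close> by (auto simp: s_def)
  have "f \<in> norm_closure KB (simple_classes M E)"
    using dense f by (auto simp: unit_sphere_def)
  then obtain k where "k \<in> simple_classes M E" "vdist KB f k < s"
    using s(1) unfolding KB.mem_norm_closure by blast
  then obtain k where k: "simple_fun M k" "vdist KB f (cls k) < s"
    by (auto simp: simple_classes_def)
  have kF: "k \<in> F"
    using k(1) by (rule simple_fun_mem)
  have d: "bnorm (\<lambda>t. f' t - k t) < s"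
    using k f' kF by (simp add: KB_simps)
  define c where "c = bnorm k"
  have "bnorm (\<lambda>t. (f' t - k t) + k t) \<le> bnorm (\<lambda>t. f' t - k t) + bnorm k"
    by (intro KB.N_triangle KB.diff_mem f' kF)
  then have c1: "c > 1 - s"
    using d f' by (simp add: c_def)
  have "bnorm (\<lambda>t. (-1) *\<^sub>R (f' t - k t) + f' t) \<le> bnorm (\<lambda>t. (-1) *\<^sub>R (f' t - k t)) + bnorm f'"
    by (intro KB.N_triangle KB.diff_mem KB.scale_mem f' kF)
  then have c2: "c < 1 + s"
    using d f' KB.N_scale[OF KB.diff_mem[OF f'(1) kF], of "-1"] by (simp add: c_def)
  have c0: "c > 0"
    using c1 s by simp
  define g where "g = (\<lambda>t. (1 / c) *\<^sub>R k t)"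
  have gF: "g \<in> F"
    unfolding g_def by (intro KB.scale_mem kF)
  have "simple_fun M g"
    unfolding g_def by (rule simple_fun_compose[OF k(1)]) simp
  moreover have "bnorm g = 1"
    using KB.N_scale[OF kF, of "1 / c"] c0 by (simp add: g_def c_def)
  moreover have "vdist KB f (cls g) < r"
  proof -
    \<comment> \<open>The second summand is the cost of normalising; its norm is
      \<open>\<bar>c - 1\<bar>\<close>.\<close>
    have eq: "f' t - g t = (f' t - k t) + (1 - 1 / c) *\<^sub>R k t" for t
      by (simp add: g_def algebra_simps)
    have "bnorm (\<lambda>t. f' t - g t) \<le> bnorm (\<lambda>t. f' t - k t) + bnorm (\<lambda>t. (1 - 1 / c) *\<^sub>R k t)"
      unfolding eq by (intro KB.N_triangle KB.diff_mem KB.scale_mem f' kF)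
    also have "bnorm (\<lambda>t. (1 - 1 / c) *\<^sub>R k t) = \<bar>1 - 1 / c\<bar> * c"
      using KB.N_scale[OF kF, of "1 - 1 / c"] by (simp add: c_def)
    also have "\<dots> = \<bar>c - 1\<bar>"
      using abs_mult_pos'[of c "1 - 1 / c"] c0 by (simp add: field_simps)
    finally show ?thesis
      using d c1 c2 s f' gF by (simp add: KB_simps)
  qed
  ultimately show thesis
    by (rule that)
qed

text \<open>Common core for both properties. The assumption on \<open>X\<close> uses families
  indexed by \<open>\<Phi>\<close> itself, so a singleton \<open>\<Phi>\<close> asks for one
  functional on \<open>X\<close> and a finite \<open>\<Phi>\<close> for finitely many.\<close>

lemma diametral_transfer:
  assumes dense: "vcarrier KB \<subseteq> norm_closure KB (simple_classes M E)"
    and \<Phi>: "finite \<Phi>" "\<Phi> \<subseteq> dual KB"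
    and X: "\<And>(x::'x) \<psi> \<delta> \<epsilon>. \<lbrakk>norm x = 1; \<And>\<phi>. \<phi> \<in> \<Phi> \<Longrightarrow> bounded_linear (\<psi> \<phi>); \<delta> > (0::real); \<epsilon> > 0\<rbrakk> \<Longrightarrow>
      \<exists>y. norm y \<le> 1 \<and> dist x y \<ge> 2 - \<epsilon> \<and> (\<forall>\<phi>\<in>\<Phi>. \<psi> \<phi> y > \<psi> \<phi> x - \<delta>)"
    and f: "f \<in> unit_sphere KB" and "\<delta> > 0" "\<epsilon> > 0"
  shows "\<exists>h\<in>unit_ball KB. vdist KB f h \<ge> 2 - \<epsilon> \<and> (\<forall>\<phi>\<in>\<Phi>. \<phi> h > \<phi> f - \<delta>)"
proof -
  interpret MS: Metric_space "vcarrier KB" "vdist KB"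
    by (rule KB.Metric_space_vdist)
  have fV: "f \<in> vcarrier KB"
    using f by (simp add: unit_sphere_def)
  obtain r where r: "r > 0"
    "\<And>h. \<lbrakk>h \<in> vcarrier KB; vdist KB f h < r\<rbrakk> \<Longrightarrow> \<forall>\<phi>\<in>\<Phi>. \<phi> h > \<phi> f - \<delta> / 2"
    using KB.ex_dual_neighbourhood[OF \<Phi> fV, of "\<delta> / 2"] \<open>\<delta> > 0\<close> by auto
  obtain g where g: "simple_fun M g" "bnorm g = 1" "vdist KB f (cls g) < min r (\<epsilon> / 2)"
    using ex_simple_near_sphere[OF dense f, of "min r (\<epsilon> / 2)"] r(1) \<open>\<epsilon> > 0\<close> by auto
  \<comment> \<open>Half of \<open>\<delta>\<close> pays for passing from \<open>f\<close> to
    \<open>g\<close>; the other half is split over the \<open>n\<close> directions, where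
    \<open>n + 1\<close> keeps the divisor positive.\<close>
  define n where "n = real (card (vals g))"
  have n: "n \<ge> 0" "n * (\<delta> / (2 * (n + 1))) \<le> \<delta> / 2"
    using \<open>\<delta> > 0\<close> by (auto simp: n_def field_simps)
  have "\<exists>y. norm y \<le> 1 \<and> dist (sgn v) y \<ge> 2 - \<epsilon> / 2 \<and>
      (\<forall>\<phi>\<in>\<Phi>. \<phi> (cls (part g v y)) > \<phi> (cls (part g v (sgn v))) - \<delta> / (2 * (n + 1)))"
    if "v \<in> vals g" for v
    using that \<open>\<delta> > 0\<close> \<open>\<epsilon> > 0\<close> n(1) bounded_linear_part[OF g(1)] \<Phi>(2)
    by (intro X) (auto simp: vals_def norm_sgn)
  then obtain y where y: "\<And>v. v \<in> vals g \<Longrightarrow> norm (y v) \<le> 1"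
    "\<And>v. v \<in> vals g \<Longrightarrow> dist (sgn v) (y v) \<ge> 2 - \<epsilon> / 2"
    "\<And>v \<phi>. \<lbrakk>v \<in> vals g; \<phi> \<in> \<Phi>\<rbrakk> \<Longrightarrow>
      \<phi> (cls (part g v (y v))) > \<phi> (cls (part g v (sgn v))) - \<delta> / (2 * (n + 1))"
    by metis
  have gV: "cls g \<in> vcarrier KB" and hV: "cls (rep g y) \<in> vcarrier KB"
    using g(1) by (auto simp: KB_simps rep_mem simple_fun_mem)
  have "\<phi> (cls (rep g y)) > \<phi> f - \<delta>" if "\<phi> \<in> \<Phi>" for \<phi>
  proof -
    have \<phi>: "\<phi> \<in> dual KB"
      using that \<Phi>(2) by auto
    have "\<phi> f - \<delta> < \<phi> (cls g) - \<delta> / 2"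
      using r(2)[OF gV] g(3) that by fastforce
    also have "\<dots> \<le> \<phi> (cls g) - n * (\<delta> / (2 * (n + 1)))"
      using n(2) by simp
    also have "\<dots> = (\<Sum>v\<in>vals g. \<phi> (cls (part g v (sgn v))) - \<delta> / (2 * (n + 1)))"
      using dual_rep[OF g(1) \<phi>, of sgn] by (simp add: rep_sgn n_def sum_subtractf)
    also have "\<dots> \<le> (\<Sum>v\<in>vals g. \<phi> (cls (part g v (y v))))"
      using y(3) that by (intro sum_mono less_imp_le)
    also have "\<dots> = \<phi> (cls (rep g y))"
      using dual_rep[OF g(1) \<phi>] by simp
    finally show ?thesis .
  qed
  \<comment> \<open>The changed function has distance at least \<open>2 - \<epsilon> / 2\<close>
    from \<open>g\<close>, and \<open>f\<close> is within \<open>\<epsilon> / 2\<close> of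
    \<open>g\<close>.\<close>
  moreover have "vdist KB f (cls (rep g y)) \<ge> 2 - \<epsilon>"
    using vdist_rep_ge[OF g(1,2), of "2 - \<epsilon> / 2" sgn y] y(2) g(3)
      MS.triangle[OF gV fV hV] MS.commute[of f "cls g"] by (simp add: rep_sgn)
  moreover have "cls (rep g y) \<in> unit_ball KB"
    using hV bnorm_rep_le[OF g(1), of y] y(1) g(2) by (simp add: unit_ball_def bnorm_cls rep_mem g(1))
  ultimately show ?thesis
    by blast
qed

lemma DD2P_KB:
  assumes "vcarrier KB \<subseteq> norm_closure KB (simple_classes M E)"
    and "DD2P (type_nspace :: 'x nspace)"
  shows "DD2P KB"
  unfolding DD2P_iff
proof (intro ballI allI impI, elim conjE)
  fix f :: "('s \<Rightarrow> 'x) set" and \<Phi> and \<delta> \<epsilon> :: real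
  assume f: "f \<in> unit_sphere KB" and \<Phi>: "finite \<Phi>" "\<Phi> \<subseteq> dual KB" and "\<delta> > 0" "\<epsilon> > 0"
  show "\<exists>h\<in>unit_ball KB. vdist KB f h \<ge> 2 - \<epsilon> \<and> (\<forall>\<phi>\<in>\<Phi>. \<phi> h > \<phi> f - \<delta>)"
  proof (rule diametral_transfer[OF assms(1) \<Phi> _ f \<open>\<delta> > 0\<close> \<open>\<epsilon> > 0\<close>])
    fix x :: 'x and \<psi> :: "_ \<Rightarrow> 'x \<Rightarrow> real" and \<delta> \<epsilon> :: real
    assume "norm x = 1" "\<And>\<phi>. \<phi> \<in> \<Phi> \<Longrightarrow> bounded_linear (\<psi> \<phi>)" "\<delta> > 0" "\<epsilon> > 0"
    then have "x \<in> unit_sphere type_nspace" "finite (\<psi> ` \<Phi>)" "\<psi> ` \<Phi> \<subseteq> dual type_nspace"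
      using \<Phi>(1) by (auto simp: unit_sphere_def dual_type_nspace)
    then obtain y where "y \<in> unit_ball type_nspace" "vdist type_nspace x y \<ge> 2 - \<epsilon>"
      "\<forall>\<phi>\<in>\<psi> ` \<Phi>. \<phi> y > \<phi> x - \<delta>"
      using assms(2) \<open>\<delta> > 0\<close> \<open>\<epsilon> > 0\<close> unfolding DD2P_iff by meson
    then show "\<exists>y. norm y \<le> 1 \<and> dist x y \<ge> 2 - \<epsilon> \<and> (\<forall>\<phi>\<in>\<Phi>. \<psi> \<phi> y > \<psi> \<phi> x - \<delta>)"
      by (auto simp: unit_ball_def)
  qed
qed

lemma DLD2P_KB:
  assumes "vcarrier KB \<subseteq> norm_closure KB (simple_classes M E)"
    and "DLD2P (type_nspace :: 'x nspace)"
  shows "DLD2P KB"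
proof (rule DLD2PI)
  fix f :: "('s \<Rightarrow> 'x) set" and \<phi> and \<delta> \<epsilon> :: real
  assume f: "f \<in> unit_sphere KB" and \<phi>: "\<phi> \<in> dual KB" and "\<delta> > 0" "\<epsilon> > 0"
  have "\<exists>h\<in>unit_ball KB. vdist KB f h \<ge> 2 - \<epsilon> \<and> (\<forall>\<phi>'\<in>{\<phi>}. \<phi>' h > \<phi>' f - \<delta>)"
  proof (rule diametral_transfer[OF assms(1) _ _ _ f \<open>\<delta> > 0\<close> \<open>\<epsilon> > 0\<close>])
    fix x :: 'x and \<psi> :: "_ \<Rightarrow> 'x \<Rightarrow> real" and \<delta> \<epsilon> :: real
    assume "norm x = 1" "\<And>\<phi>'. \<phi>' \<in> {\<phi>} \<Longrightarrow> bounded_linear (\<psi> \<phi>')" "\<delta> > 0" "\<epsilon> > 0"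
    then show "\<exists>y. norm y \<le> 1 \<and> dist x y \<ge> 2 - \<epsilon> \<and> (\<forall>\<phi>'\<in>{\<phi>}. \<psi> \<phi>' y > \<psi> \<phi>' x - \<delta>)"
      using DLD2P_type_nspaceD[OF assms(2), of x "\<psi> \<phi>" \<delta> \<epsilon>] by simp
  qed (use \<phi> in auto)
  then show "\<exists>h\<in>unit_ball KB. vdist KB f h \<ge> 2 - \<epsilon> \<and> \<phi> h > \<phi> f - \<delta>"
    by simp
qed

section \<open>Transfer of the convex DLD2P\<close>

text \<open>A nonzero vector on a set of finite nonzero measure gives a function to normalise. A
  nonempty sphere is needed to reach 0 when passing from sphere to ball.\<close>

lemma unit_sphere_nonempty:
  assumes "(UNIV :: 'x set) \<noteq> {0}"
  shows "unit_sphere KB \<noteq> {}"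
proof -
  obtain x :: 'x where x: "x \<noteq> 0"
    using assms by blast
  obtain A where A: "A \<in> sets M" "emeasure M A < \<infinity>" "emeasure M A \<noteq> 0"
    using ex_finite_nonnull_set sigma_finite_measure_axioms by blast
  define f where "f = (\<lambda>t. indicator A t *\<^sub>R x)"
  have "simple_fun M f"
    using A unfolding simple_fun_def
    by (intro exI[of _ "{A}"]) (auto simp: f_def constant_on_def indicator_def disjoint_def)
  then have fF: "f \<in> F"
    by (rule simple_fun_mem)
  have "bnorm f \<noteq> 0"
  proof
    assume "bnorm f = 0"
    then have "AE t in M. f t = 0"
      using fF by (intro KB.N_eq_0D)
    then have "AE t in M. t \<notin> A"
      by eventually_elim (use x in \<open>auto simp: f_def\<close>)
    then have "A \<in> null_sets M"
      using A(1) sets.sets_into_space by (simp add: null_sets_iff_AE)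
    then show False
      using A(3) by (simp add: null_setsD1)
  qed
  then have "cls (\<lambda>t. (1 / bnorm f) *\<^sub>R f t) \<in> unit_sphere KB"
    using fF KB.N_scale[OF fF, of "1 / bnorm f"] KB.N_nonneg[OF fF]
    by (simp add: unit_sphere_def bnorm_cls KB.scale_mem KB_simps(5))
  then show ?thesis
    by blast
qed

text \<open>
  The coordinates of \<open>y\<close> are moved into the closed convex hulls one after the other: with the other
  coordinates fixed, \<open>rep g y\<close> depends affinely and continuously on a single one.
\<close>

lemma rep_mem_closed_convex:
  assumes g: "simple_fun M g"
    and C: "vconvex KB C" "norm_closure KB C = C"
    and D: "\<And>y. (\<And>v. v \<in> vals g \<Longrightarrow> y v \<in> D v) \<Longrightarrow> cls (rep g y) \<in> C"
    and y: "\<And>v. v \<in> vals g \<Longrightarrow> y v \<in> closure (convex hull D v)"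
  shows "cls (rep g y) \<in> C"
proof -
  have "\<forall>y. (\<forall>v\<in>W. y v \<in> closure (convex hull D v)) \<and> (\<forall>v\<in>vals g - W. y v \<in> D v) \<longrightarrow>
      cls (rep g y) \<in> C" if "finite W" "W \<subseteq> vals g" for W
    using that
  proof (induction W)
    case empty
    then show ?case
      using D by simp
  next
    case (insert v W)
    show ?case
    proof (intro allI impI)
      fix y
      assume y: "(\<forall>w\<in>insert v W. y w \<in> closure (convex hull D w)) \<and>
        (\<forall>w\<in>vals g - insert v W. y w \<in> D w)"
      define Z where "Z = {z. cls (rep g (y(v := z))) \<in> C}"
      \<comment> \<open>With the value at \<open>v\<close> taken from \<open>D v\<close>, the
        modified family satisfies the premise of the induction hypothesis for
        \<open>W\<close>.\<close>
      have "D v \<subseteq> Z"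
        using y insert by (auto simp: Z_def)
      moreover have "convex Z"
      proof (rule convexI)
        fix z z' :: 'x and a b :: real
        assume *: "z \<in> Z" "z' \<in> Z" "0 \<le> a" "0 \<le> b" "a + b = 1"
        \<comment> \<open>The unchanged coordinates must equal their own combination, which holds
          since \<open>a + b = 1\<close>.\<close>
        have "a *\<^sub>R x + b *\<^sub>R x = x" for x :: 'x
          using *(5) by (simp flip: scaleR_add_left)
        then have "rep g (y(v := a *\<^sub>R z + b *\<^sub>R z'))
            = (\<lambda>t. a *\<^sub>R rep g (y(v := z)) t + b *\<^sub>R rep g (y(v := z')) t)"
          by (auto simp: rep_def fun_eq_iff scaleR_add_right scaleR_left_commute
              simp del: scaleR_scaleR)
        then have "cls (rep g (y(v := a *\<^sub>R z + b *\<^sub>R z')))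
            = vadd KB (vscale KB a (cls (rep g (y(v := z))))) (vscale KB b (cls (rep g (y(v := z')))))"
          by (simp add: KB_simps rep_mem[OF g] KB.scale_mem)
        then show "a *\<^sub>R z + b *\<^sub>R z' \<in> Z"
          using * C(1) by (simp add: Z_def vconvex_def)
      qed
      moreover have "closed Z"
        unfolding closed_limpt islimpt_approachable
      proof (intro allI impI)
        fix z assume z: "\<forall>e>0. \<exists>z'\<in>Z. z' \<noteq> z \<and> dist z' z < e"
        have "cls (rep g (y(v := z))) \<in> norm_closure KB C"
          unfolding KB.mem_norm_closure
        proof (intro conjI allI impI)
          show "cls (rep g (y(v := z))) \<in> vcarrier KB"
            by (simp add: KB_simps rep_mem[OF g])
          fix r :: real assume "r > 0"
          have nn: "bnorm g \<ge> 0"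
            by (intro KB.N_nonneg simple_fun_mem g)
          then obtain z' where z': "z' \<in> Z" "dist z' z < r / (bnorm g + 1)"
            using z \<open>r > 0\<close> by (metis add_nonneg_pos divide_pos_pos zero_less_one)
          \<comment> \<open>The two families differ only at \<open>v\<close>, so
            \<open>dist z z'\<close> bounds the distance in every coordinate. The summand 1 in
            \<open>bnorm g + 1\<close> allows for \<open>bnorm g = 0\<close>.\<close>
          have "vdist KB (cls (rep g (y(v := z)))) (cls (rep g (y(v := z')))) \<le> dist z z' * bnorm g"
            using g by (intro vdist_rep_le) auto
          also have "\<dots> \<le> dist z z' * (bnorm g + 1)"
            by (intro mult_left_mono) auto
          also have "\<dots> < r"
            using z'(2) nn by (simp add: field_simps dist_commute)
          finally show "\<exists>h\<in>C. h \<in> vcarrier KB \<and> vdist KB (cls (rep g (y(v := z)))) h < r"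
            using z'(1) by (intro bexI[of _ "cls (rep g (y(v := z')))"] conjI)
              (simp_all add: Z_def KB_simps(5) rep_mem[OF g])
        qed
        then show "z \<in> Z"
          using C(2) by (simp add: Z_def)
      qed
      ultimately have "closure (convex hull D v) \<subseteq> Z"
        by (intro closure_minimal hull_minimal)
      then have "y v \<in> Z"
        using y by blast
      then show "cls (rep g y) \<in> C"
        by (simp add: Z_def)
    qed
  qed
  from this[OF finite_vals[OF g] order_refl] y show ?thesis
    by blast
qed

text \<open>Choosing each direction in \<open>Delta\<close> of \<open>y v\<close> gives an element
  of \<open>Delta\<close> of the class of \<open>rep g y\<close>. Passing to closed convex hulls
  coordinatewise then reaches \<open>rep g y\<close> itself.\<close>

lemma rep_Delta_points:
  assumes g: "simple_fun M g" "bnorm g = 1"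
    and y: "\<And>v. v \<in> vals g \<Longrightarrow> y v \<in> Delta_points type_nspace"
  shows "cls (rep g y) \<in> Delta_points KB"
proof -
  have y1: "norm (y v) = 1" and yc: "\<epsilon> > 0 \<Longrightarrow> y v \<in> closure (convex hull Delta type_nspace \<epsilon> (y v))"
    if "v \<in> vals g" for v \<epsilon>
    using y[OF that] by (auto simp: Delta_points_def unit_sphere_def closed_convex_hull_type_nspace)
  have sphere: "cls (rep g y) \<in> unit_sphere KB"
    using g y1 by (simp add: unit_sphere_def KB_simps rep_mem bnorm_rep_cong)
  have "cls (rep g y) \<in> closed_convex_hull KB (Delta KB \<epsilon> (cls (rep g y)))" if "\<epsilon> > 0" for \<epsilon>
  proof -
    have sub: "Delta KB \<epsilon> (cls (rep g y)) \<subseteq> vcarrier KB"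
      by (auto simp: Delta_def unit_ball_def)
    show ?thesis
    proof (rule rep_mem_closed_convex[OF g(1), where D = "\<lambda>v. Delta type_nspace \<epsilon> (y v)"])
      fix z assume z: "\<And>v. v \<in> vals g \<Longrightarrow> z v \<in> Delta type_nspace \<epsilon> (y v)"
      then have z1: "\<And>v. v \<in> vals g \<Longrightarrow> norm (z v) \<le> 1"
        and z2: "\<And>v. v \<in> vals g \<Longrightarrow> 2 - \<epsilon> \<le> dist (y v) (z v)"
        by (auto simp: Delta_def unit_ball_def)
      have "cls (rep g z) \<in> Delta KB \<epsilon> (cls (rep g y))"
        using vdist_rep_ge[OF g z2] bnorm_rep_le[OF g(1) z1] g
        by (simp add: Delta_def unit_ball_def KB_simps(3,5) rep_mem)
      then show "cls (rep g z) \<in> closed_convex_hull KB (Delta KB \<epsilon> (cls (rep g y)))"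
        using KB.closed_convex_hull_superset[OF sub] by blast
    qed (use yc that KB.vconvex_closed_convex_hull[OF sub] KB.norm_closure_closed_convex_hull in auto)
  qed
  then show ?thesis
    using sphere by (simp add: Delta_points_def)
qed

text \<open>Directions \<open>sgn v\<close> lie in the closed convex hull of the \<Delta>-points of
  \<open>X\<close>, so norm-one simple functions lie in \<open>C\<close>; density extends this to
  the sphere and convexity to the ball. Conversely, the ball is closed and convex.\<close>

lemma convex_DLD2P_KB:
  assumes dense: "vcarrier KB \<subseteq> norm_closure KB (simple_classes M E)"
    and nontriv: "(UNIV :: 'x set) \<noteq> {0}"
    and X: "convex_DLD2P (type_nspace :: 'x nspace)"
  shows "convex_DLD2P KB"
proof -
  define C where "C = closed_convex_hull KB (Delta_points KB)"
  have sub: "Delta_points KB \<subseteq> unit_ball KB"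
    by (auto simp: Delta_points_def unit_sphere_def unit_ball_def)
  then have sub': "Delta_points KB \<subseteq> vcarrier KB"
    by (auto simp: unit_ball_def)
  note C = KB.vconvex_closed_convex_hull[OF sub', folded C_def]
    KB.norm_closure_closed_convex_hull[of "Delta_points KB", folded C_def]
  have simple: "cls g \<in> C" if g: "simple_fun M g" "bnorm g = 1" for g
  proof -
    have "cls (rep g sgn) \<in> C"
    proof (rule rep_mem_closed_convex[OF g(1) C, where D = "\<lambda>v. Delta_points type_nspace"])
      show "cls (rep g y) \<in> C" if "\<And>v. v \<in> vals g \<Longrightarrow> y v \<in> Delta_points type_nspace" for y
        using rep_Delta_points[OF g that] KB.closed_convex_hull_superset[OF sub']
        by (auto simp: C_def)
      show "sgn v \<in> closure (convex hull Delta_points type_nspace)" for v :: 'x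
      proof -
        have "sgn v \<in> unit_ball type_nspace"
          by (simp add: unit_ball_def norm_sgn)
        then show ?thesis
          using X by (simp add: convex_DLD2P_def closed_convex_hull_type_nspace)
      qed
    qed
    then show ?thesis
      by (simp add: rep_sgn)
  qed
  have "unit_sphere KB \<subseteq> norm_closure KB C"
  proof
    fix f assume f: "f \<in> unit_sphere KB"
    show "f \<in> norm_closure KB C"
      unfolding KB.mem_norm_closure
    proof (intro conjI allI impI)
      show "f \<in> vcarrier KB"
        using f by (simp add: unit_sphere_def)
      fix r :: real assume "r > 0"
      then obtain g where g: "simple_fun M g" "bnorm g = 1" "vdist KB f (cls g) < r"
        using ex_simple_near_sphere[OF dense f] by blast
      then show "\<exists>h\<in>C. h \<in> vcarrier KB \<and> vdist KB f h < r"
        by (intro bexI[of _ "cls g"] conjI simple KB_simps(5) simple_fun_mem)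
    qed
  qed
  then have "unit_ball KB \<subseteq> C"
    using KB.unit_ball_subset_if_unit_sphere_subset[OF C(1)] C(2) unit_sphere_nonempty[OF nontriv]
    by simp
  moreover have "C \<subseteq> unit_ball KB"
    unfolding C_def
    by (intro KB.closed_convex_hull_minimal sub KB.vconvex_unit_ball KB.norm_closure_unit_ball)
  ultimately show ?thesis
    by (simp add: convex_DLD2P_def C_def)
qed

end

section \<open>Stability of the three diametral properties under passage to
  \<open>KB\<close>\<close>

theorem theorem4p1:
  fixes M :: "'s measure" and E :: "('s \<Rightarrow> real) set" and N :: "('s \<Rightarrow> real) \<Rightarrow> real"
    and X :: "'x::banach nspace" and KB :: "('s \<Rightarrow> 'x) set nspace"
  defines "X \<equiv> type_nspace" and "KB \<equiv> koethe_bochner M E N"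
  assumes "complete_measure M" and "sigma_finite_measure M"
    and "koethe_function_space M E N"
    and "(UNIV :: 'x set) \<noteq> {0}"
    and "norm_closure KB (simple_classes M E) = vcarrier KB"
  shows "(DD2P X \<longrightarrow> DD2P KB) \<and> (DLD2P X \<longrightarrow> DLD2P KB) \<and> (convex_DLD2P X \<longrightarrow> convex_DLD2P KB)"
proof -
  interpret K: koethe_bochner_space M E N "TYPE('x)"
    using assms(3-5) by (intro koethe_bochner_space.intro)
  show ?thesis
    using assms(6,7) K.DD2P_KB K.DLD2P_KB K.convex_DLD2P_KB by (simp add: X_def KB_def)
qed

end
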